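(* Let $\mathbf{k}$ be a commutative noetherian ring. Then every twisted commutative algebra over $\mathbf{k}$ that is finitely generated in degree $1$ is noetherian.
   Context: A twisted commutative algebra (tca) over $\mathbf{k}$ is an associative unital graded $\mathbf{k}$-algebra $A=\bigoplus_{n\ge0}A_n$ equipped with a ($\mathbf{k}$-linear, left) action of the symmetric group $S_n$ on $A_n$ such that: (1) the multiplication map $A_n\otimes A_m\to A_{n+m}$ is $(S_n\times S_m)$-equivariant, using the standard embedding $S_n\times S_m\subset S_{n+m}$; and (2) for $x\in A_n$, $y\in A_m$ one has $xy=\tau\cdot(yx)$, where $\tau\in S_{n+m}$ is given by $\tau(i)=i+n$ for $1\le i\le m$ and $\tau(i)=i-m$ for $m+1\le i\le n+m$. An $A$-module is a graded (left) $A$-module $M=\bigoplus_{n\ge0}M_n$ equipped with an action of $S_n$ on $M_n$ such that each multiplication map $A_n\otimes M_m\to M_{n+m}$ is $(S_n\times S_m)$-equivariant. Submodules are graded $A$-submodules stable under the symmetric group actions. A tca (or a module) is generated by a set of homogeneous elements if the smallest sub-tca (respectively submodule) containing the set is everything. "Finitely generated in degree $1$" means generated as a tca over $\mathbf{k}$ by finitely many elements of $A_1$. A tca $A$ is noetherian if every submodule of a finitely generated $A$-module is finitely generated. *)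

theory Defs
  imports "HOL-Algebra.Sym_Groups" "HOL-Algebra.Group_Action" "HOL-Algebra.Subrings"
    "HOL-Algebra.Ring_Divisibility" "HOL-Algebra.Module"
begin

text \<open>
  A graded \<open>R\<close>-module with symmetric group actions: \<open>grade M n\<close> is the degree \<open>n\<close> part, and
  \<open>perm_act M n \<sigma> x\<close> is the action of \<open>\<sigma>\<close>, a permutation of \<open>{1..n}\<close>, on \<open>x \<in> grade M n\<close>.
  The degree is an explicit argument of the action because a permutation of \<open>{1..n}\<close> is also a
  permutation of \<open>{1..n + 1}\<close>.  For the modules below, the ring fields \<open>mult\<close> and \<open>one\<close>
  inherited by the record are not used (as for \<^locale>\<open>module\<close>).
\<close>

record ('k, 'm) sym_module = "('k, 'm) module" +
  grade :: "nat \<Rightarrow> 'm set"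
  perm_act :: "nat \<Rightarrow> (nat \<Rightarrow> nat) \<Rightarrow> 'm \<Rightarrow> 'm"

definition homogeneous_components ::
    "('k, 'm, 'z) sym_module_scheme \<Rightarrow> 'm \<Rightarrow> (nat \<Rightarrow> 'm) \<Rightarrow> bool" where
  "homogeneous_components M x c \<longleftrightarrow>
     (\<forall>n. c n \<in> grade M n) \<and>
     finite {n. c n \<noteq> \<zero>\<^bsub>M\<^esub>} \<and>
     x = finsum M c {n. c n \<noteq> \<zero>\<^bsub>M\<^esub>}"

text \<open>
  The action is restricted to \<open>grade M n\<close> because \<^const>\<open>BijGroup\<close> consists of extensional
  functions; thus nothing is required of \<open>perm_act M n\<close> outside \<open>grade M n\<close>.
\<close>

locale graded_sym_module = module R M
    for R :: "('k, 'r) ring_scheme" (structure)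
    and M :: "('k, 'm, 'z) sym_module_scheme" (structure) +
  assumes grade_submodule: "submodule (grade M n) R M"
    and direct_sum: "x \<in> carrier M \<Longrightarrow> \<exists>!c. homogeneous_components M x c"
    and perm_group_action:
      "group_action (sym_group n) (grade M n) (\<lambda>\<sigma>. restrict (perm_act M n \<sigma>) (grade M n))"
    and perm_add:
      "\<lbrakk>\<sigma> \<in> carrier (sym_group n); x \<in> grade M n; y \<in> grade M n\<rbrakk> \<Longrightarrow>
        perm_act M n \<sigma> (x \<oplus>\<^bsub>M\<^esub> y) = perm_act M n \<sigma> x \<oplus>\<^bsub>M\<^esub> perm_act M n \<sigma> y"
    and perm_smult:
      "\<lbrakk>\<sigma> \<in> carrier (sym_group n); a \<in> carrier R; x \<in> grade M n\<rbrakk> \<Longrightarrow>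
        perm_act M n \<sigma> (a \<odot>\<^bsub>M\<^esub> x) = a \<odot>\<^bsub>M\<^esub> perm_act M n \<sigma> x"

definition graded_stable :: "('k, 'm, 'z) sym_module_scheme \<Rightarrow> 'm set \<Rightarrow> bool" where
  "graded_stable M N \<longleftrightarrow>
     (\<forall>x\<in>N. \<forall>c. homogeneous_components M x c \<longrightarrow> (\<forall>n. c n \<in> N)) \<and>
     (\<forall>n. \<forall>\<sigma>\<in>carrier (sym_group n). \<forall>x \<in> N \<inter> grade M n. perm_act M n \<sigma> x \<in> N)"

text \<open>
  \<open>block_perm n \<sigma> \<rho>\<close> is the image of \<open>(\<sigma>, \<rho>)\<close> under the standard embedding of
  \<open>S\<^sub>n \<times> S\<^sub>m\<close> in \<open>S\<^sub>n\<^sub>+\<^sub>m\<close>: \<open>\<sigma>\<close> acts on \<open>{1..n}\<close> and \<open>\<rho>\<close>, shifted by \<open>n\<close>, on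
  \<open>{n + 1..n + m}\<close>.
\<close>

definition block_perm :: "nat \<Rightarrow> (nat \<Rightarrow> nat) \<Rightarrow> (nat \<Rightarrow> nat) \<Rightarrow> nat \<Rightarrow> nat" where
  "block_perm n \<sigma> \<rho> i = (if i \<le> n then \<sigma> i else n + \<rho> (i - n))"

definition block_swap :: "nat \<Rightarrow> nat \<Rightarrow> nat \<Rightarrow> nat" where
  "block_swap n m i =
     (if 1 \<le> i \<and> i \<le> m then i + n
      else if m + 1 \<le> i \<and> i \<le> n + m then i - m
      else i)"

locale twisted_comm_algebra = ring A + graded_sym_module R A
    for R :: "('k, 'r) ring_scheme" (structure)
    and A :: "('k, 'a) sym_module" (structure) +
  assumes mult_smult_left:
      "\<lbrakk>c \<in> carrier R; x \<in> carrier A; y \<in> carrier A\<rbrakk> \<Longrightarrow>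
        (c \<odot>\<^bsub>A\<^esub> x) \<otimes>\<^bsub>A\<^esub> y = c \<odot>\<^bsub>A\<^esub> (x \<otimes>\<^bsub>A\<^esub> y)"
    and mult_smult_right:
      "\<lbrakk>c \<in> carrier R; x \<in> carrier A; y \<in> carrier A\<rbrakk> \<Longrightarrow>
        x \<otimes>\<^bsub>A\<^esub> (c \<odot>\<^bsub>A\<^esub> y) = c \<odot>\<^bsub>A\<^esub> (x \<otimes>\<^bsub>A\<^esub> y)"
    and one_grade: "\<one>\<^bsub>A\<^esub> \<in> grade A 0"
    and mult_grade:
      "\<lbrakk>x \<in> grade A n; y \<in> grade A m\<rbrakk> \<Longrightarrow> x \<otimes>\<^bsub>A\<^esub> y \<in> grade A (n + m)"
    and mult_equivariant:
      "\<lbrakk>\<sigma> \<in> carrier (sym_group n); \<rho> \<in> carrier (sym_group m);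
        x \<in> grade A n; y \<in> grade A m\<rbrakk> \<Longrightarrow>
        perm_act A (n + m) (block_perm n \<sigma> \<rho>) (x \<otimes>\<^bsub>A\<^esub> y)
          = perm_act A n \<sigma> x \<otimes>\<^bsub>A\<^esub> perm_act A m \<rho> y"
    and twisted_comm:
      "\<lbrakk>x \<in> grade A n; y \<in> grade A m\<rbrakk> \<Longrightarrow>
        x \<otimes>\<^bsub>A\<^esub> y = perm_act A (n + m) (block_swap n m) (y \<otimes>\<^bsub>A\<^esub> x)"

definition sub_tca ::
    "('k, 'r) ring_scheme \<Rightarrow> ('k, 'a) sym_module \<Rightarrow> 'a set \<Rightarrow> bool" where
  "sub_tca R A B \<longleftrightarrow> submodule B R A \<and> subring B A \<and> graded_stable A B"

definition tca_generated ::
    "('k, 'r) ring_scheme \<Rightarrow> ('k, 'a) sym_module \<Rightarrow> 'a set \<Rightarrow> 'a set" where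
  "tca_generated R A S = \<Inter>{B. sub_tca R A B \<and> S \<subseteq> B}"

definition finitely_generated_degree_one ::
    "('k, 'r) ring_scheme \<Rightarrow> ('k, 'a) sym_module \<Rightarrow> bool" where
  "finitely_generated_degree_one R A \<longleftrightarrow>
     (\<exists>S. finite S \<and> S \<subseteq> grade A 1 \<and> tca_generated R A S = carrier A)"

record ('k, 'a, 'm) act_module = "('k, 'm) sym_module" +
  lact :: "'a \<Rightarrow> 'm \<Rightarrow> 'm"

locale tca_module =
  A: twisted_comm_algebra R A + M: graded_sym_module R M
    for R :: "('k, 'r) ring_scheme"
    and A :: "('k, 'a) sym_module"
    and M :: "('k, 'a, 'm) act_module" +
  assumes lact_closed:
      "\<lbrakk>a \<in> carrier A; x \<in> carrier M\<rbrakk> \<Longrightarrow> lact M a x \<in> carrier M"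
    and lact_add_left:
      "\<lbrakk>a \<in> carrier A; b \<in> carrier A; x \<in> carrier M\<rbrakk> \<Longrightarrow>
        lact M (a \<oplus>\<^bsub>A\<^esub> b) x = lact M a x \<oplus>\<^bsub>M\<^esub> lact M b x"
    and lact_add_right:
      "\<lbrakk>a \<in> carrier A; x \<in> carrier M; y \<in> carrier M\<rbrakk> \<Longrightarrow>
        lact M a (x \<oplus>\<^bsub>M\<^esub> y) = lact M a x \<oplus>\<^bsub>M\<^esub> lact M a y"
    and lact_smult_left:
      "\<lbrakk>c \<in> carrier R; a \<in> carrier A; x \<in> carrier M\<rbrakk> \<Longrightarrow>
        lact M (c \<odot>\<^bsub>A\<^esub> a) x = c \<odot>\<^bsub>M\<^esub> lact M a x"
    and lact_smult_right:
      "\<lbrakk>c \<in> carrier R; a \<in> carrier A; x \<in> carrier M\<rbrakk> \<Longrightarrow>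
        lact M a (c \<odot>\<^bsub>M\<^esub> x) = c \<odot>\<^bsub>M\<^esub> lact M a x"
    and lact_one: "x \<in> carrier M \<Longrightarrow> lact M \<one>\<^bsub>A\<^esub> x = x"
    and lact_mult:
      "\<lbrakk>a \<in> carrier A; b \<in> carrier A; x \<in> carrier M\<rbrakk> \<Longrightarrow>
        lact M (a \<otimes>\<^bsub>A\<^esub> b) x = lact M a (lact M b x)"
    and lact_grade:
      "\<lbrakk>a \<in> grade A n; x \<in> grade M m\<rbrakk> \<Longrightarrow> lact M a x \<in> grade M (n + m)"
    and lact_equivariant:
      "\<lbrakk>\<sigma> \<in> carrier (sym_group n); \<rho> \<in> carrier (sym_group m);
        a \<in> grade A n; x \<in> grade M m\<rbrakk> \<Longrightarrow>
        perm_act M (n + m) (block_perm n \<sigma> \<rho>) (lact M a x)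
          = lact M (perm_act A n \<sigma> a) (perm_act M m \<rho> x)"

definition tca_submodule ::
    "('k, 'r) ring_scheme \<Rightarrow> ('k, 'a) sym_module \<Rightarrow> ('k, 'a, 'm) act_module \<Rightarrow> 'm set \<Rightarrow> bool"
  where
  "tca_submodule R A M N \<longleftrightarrow>
     submodule N R M \<and>
     (\<forall>a\<in>carrier A. \<forall>x\<in>N. lact M a x \<in> N) \<and>
     graded_stable M N"

definition submodule_generated ::
    "('k, 'r) ring_scheme \<Rightarrow> ('k, 'a) sym_module \<Rightarrow> ('k, 'a, 'm) act_module \<Rightarrow> 'm set \<Rightarrow> 'm set"
  where
  "submodule_generated R A M S = \<Inter>{N. tca_submodule R A M N \<and> S \<subseteq> N}"

text \<open>
  Finite generation of a submodule \<open>N\<close> of \<open>M\<close>, by homogeneous elements; for \<open>N = carrier M\<close>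
  this is finite generation of \<open>M\<close> itself.
\<close>

definition finitely_generated_submodule ::
    "('k, 'r) ring_scheme \<Rightarrow> ('k, 'a) sym_module \<Rightarrow> ('k, 'a, 'm) act_module \<Rightarrow> 'm set \<Rightarrow> bool"
  where
  "finitely_generated_submodule R A M N \<longleftrightarrow>
     (\<exists>S. finite S \<and> S \<subseteq> (\<Union>n. grade M n) \<and> submodule_generated R A M S = N)"

text \<open>
  A definition cannot quantify over types, so the type \<open>'m\<close> carrying the modules is a parameter;
  a theorem with \<open>'m\<close> left free covers modules over all types.
\<close>

definition noetherian_tca ::
    "'m itself \<Rightarrow> ('k, 'r) ring_scheme \<Rightarrow> ('k, 'a) sym_module \<Rightarrow> bool" where
  "noetherian_tca _ R A \<longleftrightarrow>
     (\<forall>M :: ('k, 'a, 'm) act_module.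
        tca_module R A M \<and> finitely_generated_submodule R A M (carrier M) \<longrightarrow>
        (\<forall>N. tca_submodule R A M N \<longrightarrow> finitely_generated_submodule R A M N))"

end

theory Submission
  imports Defs "HOL-Library.Sublist" "HOL-Library.Infinite_Set" "HOL-Library.List_Lexorder"
begin

text \<open>
  Let \<open>A\<close> be generated by \<open>s\<^sub>0, \<dots>, s\<^sub>d\<^sub>-\<^sub>1\<close> in degree 1, and \<open>M\<close> by finitely many homogeneous elements \<open>t\<^sub>j\<close>.
  By twisted commutativity the element \<open>\<sigma> \<cdot> (s\<^sub>c\<^sub>1 \<dots> s\<^sub>c\<^sub>k t\<^sub>j)\<close> depends only on \<open>j\<close> and on a word over a finite
  alphabet, and these elements span \<open>M\<close> over the ground ring.  Inserting a letter \<open>c\<close> into a word is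
  realised by multiplication with \<open>s\<^sub>c\<close> followed by a permutation, and it preserves the lexicographic
  order of words of equal length.  Hence, for a submodule \<open>N\<close>, the ideal of leading coefficients of
  elements of \<open>N\<close> at a word grows along the subsequence order.  By Higman's lemma and the ascending
  chain condition, finitely many words determine all these ideals, and lifts of generators of the
  ideals at those words generate \<open>N\<close>.
\<close>

section \<open>Almost full relations and Higman's lemma\<close>

text \<open>In the free tca on \<open>d\<close> generators of degree 1, the part of degree n is free
  on the words of length n in \<open>d\<close> letters, with permutation of places. In a free module
  on one generator of degree e, the basis words also contain e distinct marks, once each. Every
  \<open>M\<close> as above is a quotient of a finite sum of such modules, and the proof is a
  Groebner basis argument in this cover, carried out with values in \<open>M\<close> so that the
  cover need not be built. Two obstacles shape it. First, multiplication inserts letters but not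
  marks; the subsequence order is usable because words that belong to the same generator have
  equally many marks. Second, over a field a coefficient ideal is zero or everything, but in general
  the ideal at a word can be strictly larger than at all of its proper subsequences, so a finite
  basis for the subsequence order alone is not enough. The relation shown to be almost full is
  therefore the finer one, subsequence together with equality of ideals. Reduction by leading words
  terminates since each degree has only finitely many words.\<close>

definition almost_full_on :: "('a \<Rightarrow> 'a \<Rightarrow> bool) \<Rightarrow> 'a set \<Rightarrow> bool" where
  "almost_full_on P A \<longleftrightarrow> (\<forall>f :: nat \<Rightarrow> 'a. range f \<subseteq> A \<longrightarrow> (\<exists>i j. i < j \<and> P (f i) (f j)))"

text \<open>Nash-Williams' minimal bad sequence argument.\<close>

lemma almost_full_on_subseq:
  fixes K :: "'a set"
  assumes "finite K"
  shows "almost_full_on subseq (lists K)"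
proof (rule ccontr)
  define bad where "bad f \<longleftrightarrow> range f \<subseteq> lists K \<and> (\<forall>i j. i < j \<longrightarrow> \<not> subseq (f i) (f j))"
    for f :: "nat \<Rightarrow> 'a list"
  \<comment> \<open>Minimality concerns only the length of the term at index \<open>n\<close>, among
    the bad sequences with the same first \<open>n\<close> terms.\<close>
  define minimal_at where "minimal_at n f \<longleftrightarrow> bad f \<and>
      (\<forall>h. bad h \<longrightarrow> (\<forall>i<n. h i = f i) \<longrightarrow> length (f n) \<le> length (h n))" for n f
  have ex_min: "\<exists>f'. minimal_at n f' \<and> (\<forall>i<n. f' i = f i)" if "bad f" for n f
  proof -
    have "bad f \<and> (\<forall>i<n. f i = f i)" using that by simp
    from ex_has_least_nat[where m = "\<lambda>h. length (h n)" and P = "\<lambda>h. bad h \<and> (\<forall>i<n. h i = f i)", OF this]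
    show ?thesis
      unfolding minimal_at_def by (metis (no_types, lifting))
  qed
  assume "\<not> almost_full_on subseq (lists K)"
  then obtain f0 where f0: "bad f0" unfolding almost_full_on_def bad_def by auto
  have "\<exists>F. \<forall>n. minimal_at n (F n) \<and> (\<forall>i<Suc n. F (Suc n) i = F n i)"
  proof (rule dependent_nat_choice)
    show "\<exists>f. minimal_at 0 f" using ex_min[OF f0] by blast
    show "\<exists>f'. minimal_at (Suc n) f' \<and> (\<forall>i<Suc n. f' i = f i)" if "minimal_at n f" for f n
      using ex_min[of f] that unfolding minimal_at_def by blast
  qed
  then obtain F where Fmin: "\<And>n. minimal_at n (F n)"
    and FSuc: "\<And>n i. i < Suc n \<Longrightarrow> F (Suc n) i = F n i" by blast
  have F_eq: "F m i = F n i" if "n \<le> m" "i \<le> n" for m n i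
    using that by (induction m rule: dec_induct) (auto simp: FSuc)
  \<comment> \<open>The diagonal sequence: the terms of \<open>F n\<close> up to index
    \<open>n\<close> are never changed at later stages, so \<open>g\<close> inherits both badness
    and minimality.\<close>
  define g where "g n = F n n" for n
  have g_eq: "F n i = g i" if "i \<le> n" for n i
    using F_eq[of i n i] that by (simp add: g_def)
  have bad_g: "\<not> subseq (g i) (g j)" if "i < j" for i j
  proof -
    have "\<not> subseq (F j i) (F j j)"
      using Fmin[of j] that unfolding minimal_at_def bad_def by blast
    then show ?thesis using g_eq[of i j] g_eq[of j j] that by simp
  qed
  have g_K: "set (g i) \<subseteq> K" for i
    using Fmin[of i] unfolding minimal_at_def bad_def g_def by auto
  have g_ne: "g n \<noteq> []" for n
    using bad_g[of n "Suc n"] by auto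
  then have "hd (g n) \<in> K" for n
    using g_K[of n] hd_in_set[of "g n"] by blast
  \<comment> \<open>The alphabet is finite, so one letter starts infinitely many terms. Deleting it
    from these terms yields a shorter bad sequence.\<close>
  then obtain n where "infinite {m. hd (g m) = hd (g n)}"
    using pigeonhole_infinite[of "UNIV :: nat set" "\<lambda>m. hd (g m)"] assms
      finite_subset[of "range (\<lambda>m. hd (g m))" K] by auto
  moreover define I where "I = {m. hd (g m) = hd (g n)}"
  ultimately have "infinite I" by simp
  define e where "e = enumerate I"
  have e_mono: "e i < e j" if "i < j" for i j
    unfolding e_def using \<open>infinite I\<close> that by (simp add: enumerate_mono)
  have e_I: "hd (g (e i)) = hd (g n)" for i
    using enumerate_in_set[OF \<open>infinite I\<close>, of i] by (simp add: e_def I_def)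
  have g_e: "g (e i) = hd (g n) # tl (g (e i))" for i
    using g_ne[of "e i"] e_I[of i] by (metis list.collapse)
  define n0 where "n0 = e 0"
  have n0_le: "n0 \<le> e i" for i
    using e_mono[of 0 i] unfolding n0_def by (cases i) auto
  \<comment> \<open>Up to \<open>n0\<close> nothing changes, so \<open>h\<close> competes with
    \<open>F n0\<close>; its term at \<open>n0\<close> has lost a letter, which contradicts
    minimality.\<close>
  define h where "h k = (if k < n0 then g k else tl (g (e (k - n0))))" for k
  have "bad h"
    unfolding bad_def
  proof (intro conjI allI impI)
    have "set (h k) \<subseteq> K" for k
      using g_K[of k] g_K[of "e (k - n0)"] list.set_sel(2)[OF g_ne] by (auto simp: h_def)
    then show "range h \<subseteq> lists K" by auto
    fix i j :: nat assume "i < j"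
    consider "j < n0" | "i < n0" "n0 \<le> j" | "n0 \<le> i" by linarith
    then show "\<not> subseq (h i) (h j)"
    proof cases
      case 1
      then show ?thesis using bad_g \<open>i < j\<close> by (simp add: h_def)
    next
      case 2
      then have "i < e (j - n0)" using n0_le[of "j - n0"] by linarith
      then have "\<not> subseq (g i) (hd (g n) # tl (g (e (j - n0))))"
        using bad_g g_e[of "j - n0"] by metis
      then show ?thesis using 2 by (auto simp: h_def)
    next
      case 3
      then have "e (i - n0) < e (j - n0)" using \<open>i < j\<close> by (intro e_mono) linarith
      then have "\<not> subseq (hd (g n) # tl (g (e (i - n0)))) (hd (g n) # tl (g (e (j - n0))))"
        using bad_g g_e by metis
      then show ?thesis using 3 \<open>i < j\<close> by (simp add: h_def)
    qed
  qed
  moreover have "\<forall>i<n0. h i = F n0 i" using g_eq by (simp add: h_def)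
  ultimately have "length (F n0 n0) \<le> length (h n0)"
    using Fmin[of n0] unfolding minimal_at_def by blast
  moreover have "length (h n0) < length (g n0)"
    using g_ne[of n0] by (simp add: h_def n0_def)
  ultimately show False using g_eq[of n0 n0] by simp
qed

lemma almost_full_on_subset: "almost_full_on P B \<Longrightarrow> A \<subseteq> B \<Longrightarrow> almost_full_on P A"
  unfolding almost_full_on_def by blast

text \<open>The indices without a later partner form a finite set, since infinitely many of them
  would enumerate a bad sequence. Beyond that set a chain can always be continued. Only consecutive
  links are claimed, which is enough to obtain an ascending chain of ideals.\<close>

lemma almost_full_on_ascending:
  assumes af: "almost_full_on P A" and f: "range f \<subseteq> A"
  obtains h :: "nat \<Rightarrow> nat" where "strict_mono h" "\<And>n. P (f (h n)) (f (h (Suc n)))"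
proof -
  define T where "T = {i. \<forall>j>i. \<not> P (f i) (f j)}"
  have "finite T"
  proof (rule ccontr)
    assume "infinite T"
    then have "\<not> P (f (enumerate T i)) (f (enumerate T j))" if "i < j" for i j
      using that enumerate_in_set[of T i] enumerate_mono[of i j T] by (auto simp: T_def)
    moreover have "range (\<lambda>i. f (enumerate T i)) \<subseteq> A" using f by auto
    ultimately show False using af unfolding almost_full_on_def by blast
  qed
  then obtain b where b: "\<And>i. i \<in> T \<Longrightarrow> i < b"
    by (meson finite_nat_set_iff_bounded)
  have "\<exists>h. \<forall>n. b \<le> h n \<and> (h n < h (Suc n) \<and> P (f (h n)) (f (h (Suc n))))"
  proof (rule dependent_nat_choice)
    show "\<exists>y. b \<le> y \<and> x < y \<and> P (f x) (f y)" if "b \<le> x" for x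
    proof -
      have "x \<notin> T" using b[of x] that by auto
      then obtain y where "x < y" "P (f x) (f y)" by (auto simp: T_def)
      then show ?thesis using that by (intro exI[of _ y]) auto
    qed
  qed auto
  then show ?thesis using that by (auto simp: strict_mono_Suc_iff)
qed

text \<open>If no finite set worked, repeatedly adding an element that lies above none of those
  already picked would produce a bad sequence.\<close>

lemma almost_full_on_finite_basis:
  assumes "almost_full_on P A"
  obtains F where "finite F" "F \<subseteq> A" "\<And>w. w \<in> A \<Longrightarrow> \<exists>u\<in>F. P u w"
proof -
  define avoids where "avoids F w \<longleftrightarrow> w \<in> A \<and> (\<forall>u\<in>F. \<not> P u w)" for F w
  have "\<exists>F. finite F \<and> F \<subseteq> A \<and> (\<forall>w. \<not> avoids F w)"
  proof (rule ccontr)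
    assume "\<nexists>F. finite F \<and> F \<subseteq> A \<and> (\<forall>w. \<not> avoids F w)"
    then have ex: "\<exists>w. avoids F w" if "finite F" "F \<subseteq> A" for F
      using that by metis
    define pick where "pick F = (SOME w. avoids F w)" for F
    have pick: "avoids F (pick F)" if "finite F" "F \<subseteq> A" for F
      unfolding pick_def by (rule someI_ex[OF ex[OF that]])
    define S where "S n = ((\<lambda>F. insert (pick F) F) ^^ n) {}" for n :: nat
    have S_Suc: "S (Suc n) = insert (pick (S n)) (S n)" for n by (simp add: S_def)
    have S: "finite (S n) \<and> S n \<subseteq> A" for n
    proof (induction n)
      case (Suc n)
      then show ?case using pick[of "S n"] by (simp add: S_Suc avoids_def)
    qed (simp add: S_def)
    have in_later: "pick (S i) \<in> S j" if "i < j" for i j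
      using that by (induction j) (auto simp: S_Suc less_Suc_eq)
    have "avoids (S n) (pick (S n))" for n using pick S by blast
    then have "\<not> P (pick (S i)) (pick (S j))" and "pick (S i) \<in> A" if "i < j" for i j
      using in_later[OF that] unfolding avoids_def by blast+
    then have "\<forall>i j. i < j \<longrightarrow> \<not> P (pick (S i)) (pick (S j))" "range (\<lambda>n. pick (S n)) \<subseteq> A"
      by blast+
    then show False using assms unfolding almost_full_on_def by metis
  qed
  then show ?thesis using that unfolding avoids_def by metis
qed

section \<open>Words\<close>

text \<open>The set \<open>S\<close> will consist of the letters that stand for generators of the
  algebra, the ones that multiplication can insert.\<close>

inductive single_insert :: "'a set \<Rightarrow> 'a list \<Rightarrow> 'a list \<Rightarrow> bool" for S where
  "c \<in> S \<Longrightarrow> single_insert S (xs @ ys) (xs @ c # ys)"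

lemma single_insert_Cons: "single_insert S u w \<Longrightarrow> single_insert S (a # u) (a # w)"
proof (induction rule: single_insert.induct)
  case (1 c xs ys)
  then show ?case using single_insert.intros[of c S "a # xs" ys] by simp
qed

text \<open>Equal numbers of letters outside \<open>S\<close> leave no room for skipping such a
  letter, so every skipped letter can be supplied by an admissible insertion.\<close>

lemma subseq_imp_single_inserts:
  assumes "subseq u w" "length (filter (\<lambda>c. c \<notin> S) u) = length (filter (\<lambda>c. c \<notin> S) w)"
  shows "(single_insert S)\<^sup>*\<^sup>* u w"
  using assms
proof (induction rule: list_emb.induct)
  case (list_emb_Nil ys)
  then have "set ys \<subseteq> S" by (auto simp: filter_empty_conv)
  then show ?case
  proof (induction ys)
    case (Cons c ys)
    then show ?case using single_insert.intros[of c S "[]" ys]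
      by (simp add: rtranclp.rtrancl_into_rtrancl)
  qed auto
next
  case (list_emb_Cons xs ys y)
  \<comment> \<open>If the skipped letter \<open>y\<close> were outside \<open>S\<close>, this
    inequality would make the two counts differ.\<close>
  have "length (filter (\<lambda>c. c \<notin> S) xs) \<le> length (filter (\<lambda>c. c \<notin> S) ys)"
    using list_emb_length[OF subseq_filter[OF list_emb_Cons.hyps]] .
  then have "y \<in> S" and "(single_insert S)\<^sup>*\<^sup>* xs ys"
    using list_emb_Cons by (auto split: if_splits)
  then show ?case using single_insert.intros[of y S "[]" ys]
    by (simp add: rtranclp.rtrancl_into_rtrancl)
next
  case (list_emb_Cons2 x y xs ys)
  then have "(single_insert S)\<^sup>*\<^sup>* xs ys" by (auto split: if_splits)
  then have "(single_insert S)\<^sup>*\<^sup>* (x # xs) (x # ys)"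
    by (induction rule: rtranclp_induct) (auto intro: single_insert_Cons rtranclp.rtrancl_into_rtrancl)
  then show ?case using list_emb_Cons2 by simp
qed

lemma less_append_same_length:
  fixes xs xs' ys ys' :: "'a :: linorder list"
  assumes "length xs = length xs'"
  shows "xs @ ys < xs' @ ys' \<longleftrightarrow> xs < xs' \<or> xs = xs' \<and> ys < ys'"
  using assms by (induction xs xs' rule: list_induct2) auto

text \<open>The same letter enters both words at the same place, so the first difference stays
  decisive. This is the compatibility of the word order with multiplication.\<close>

lemma insert_letter_less:
  fixes xs xs' ys ys' :: "'a :: linorder list"
  assumes "length xs = length xs'" "xs @ ys < xs' @ ys'"
  shows "xs @ c # ys < xs' @ c # ys'"
  using assms by (auto simp: less_append_same_length)

text \<open>Positions are counted from 1, and \<open>\<sigma>\<close> moves the letter at position \<open>i\<close> to position \<open>\<sigma> i\<close>;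
  this makes \<open>permute_word\<close> a left action.\<close>

definition permute_word :: "(nat \<Rightarrow> nat) \<Rightarrow> 'a list \<Rightarrow> 'a list" where
  "permute_word \<sigma> xs = map (\<lambda>i. xs ! (inv' \<sigma> (Suc i) - 1)) [0..<length xs]"

lemma length_permute_word [simp]: "length (permute_word \<sigma> xs) = length xs"
  by (simp add: permute_word_def)

text \<open>Checks a permuted word at the target places, so that the inverse permutation in the
  definition need not be computed for explicit permutations.\<close>

lemma permute_word_eqI:
  assumes \<sigma>: "\<sigma> permutes {1..length xs}" and len: "length ys = length xs"
    and nth: "\<And>i. i < length xs \<Longrightarrow> ys ! (\<sigma> (Suc i) - 1) = xs ! i"
  shows "permute_word \<sigma> xs = ys"
proof (rule nth_equalityI)
  fix i assume "i < length (permute_word \<sigma> xs)"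
  then have i: "Suc i \<in> {1..length xs}" by simp
  define k where "k = inv' \<sigma> (Suc i)"
  have k: "k \<in> {1..length xs}" "\<sigma> k = Suc i"
    using permutes_in_image[OF permutes_inv[OF \<sigma>]] permutes_inverses[OF \<sigma>] i
    unfolding k_def by auto
  then have "k - 1 < length xs" "Suc (k - 1) = k" by auto
  then show "permute_word \<sigma> xs ! i = ys ! i"
    using nth[of "k - 1"] i k(2) by (simp add: permute_word_def flip: k_def)
qed (simp add: len)

lemma nth_permute_word:
  assumes \<sigma>: "\<sigma> permutes {1..length xs}" and "i < length xs"
  shows "permute_word \<sigma> xs ! (\<sigma> (Suc i) - 1) = xs ! i"
proof -
  have "\<sigma> (Suc i) \<in> {1..length xs}" using permutes_in_image[OF \<sigma>] assms(2) by auto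
  then have "\<sigma> (Suc i) - 1 < length xs" "Suc (\<sigma> (Suc i) - 1) = \<sigma> (Suc i)" by auto
  then show ?thesis
    using permutes_inverses(2)[OF \<sigma>, of "Suc i"] by (simp add: permute_word_def del: One_nat_def)
qed

lemma permute_word_id [simp]: "permute_word id xs = xs"
  by (rule permute_word_eqI) (auto simp: permutes_id)

lemma permute_word_comp:
  assumes "\<sigma> permutes {1..length xs}" "\<rho> permutes {1..length xs}"
  shows "permute_word (\<sigma> \<circ> \<rho>) xs = permute_word \<sigma> (permute_word \<rho> xs)"
proof (rule permute_word_eqI)
  fix i assume i: "i < length xs"
  have "\<rho> (Suc i) \<in> {1..length xs}" using permutes_in_image[OF assms(2)] i by auto
  then show "permute_word \<sigma> (permute_word \<rho> xs) ! ((\<sigma> \<circ> \<rho>) (Suc i) - 1) = xs ! i"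
    using nth_permute_word[of \<sigma> "permute_word \<rho> xs" "\<rho> (Suc i) - 1"]
      nth_permute_word[OF assms(2) i] assms(1) by (auto simp: Suc_le_eq)
qed (simp_all add: permutes_compose[OF assms(2,1)] del: One_nat_def)

lemma mset_permute_word:
  assumes "\<sigma> permutes {1..length xs}"
  shows "mset (permute_word \<sigma> xs) = mset xs"
proof -
  define \<tau> where "\<tau> i = inv' \<sigma> (Suc i) - 1" for i
  have "Suc (\<tau> i) = inv' \<sigma> (Suc i)" "\<tau> i < length xs" if "i < length xs" for i
    using permutes_in_image[OF permutes_inv[OF assms], of "Suc i"] that by (auto simp: \<tau>_def)
  moreover have "inj (inv' \<sigma>)" by (rule permutes_inj[OF permutes_inv[OF assms]])
  ultimately have "inj_on \<tau> {..<length xs}" "\<tau> ` {..<length xs} \<subseteq> {..<length xs}"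
    by (auto simp: inj_on_def dest!: injD) (metis Suc_inject injD)
  then have bij: "bij_betw \<tau> {..<length xs} {..<length xs}"
    by (simp add: bij_betw_def endo_inj_surj)
  have "mset (permute_word \<sigma> xs) = image_mset (\<lambda>i. xs ! \<tau> i) (mset_set {..<length xs})"
    by (simp add: permute_word_def \<tau>_def atLeast0LessThan)
  also have "\<dots> = image_mset (\<lambda>i. xs ! i) (image_mset \<tau> (mset_set {..<length xs}))"
    by (simp add: image_mset.compositionality comp_def)
  also have "image_mset \<tau> (mset_set {..<length xs}) = mset_set {..<length xs}"
    using image_mset_mset_set[of \<tau> "{..<length xs}"] bij by (simp add: bij_betw_def)
  also have "image_mset (\<lambda>i. xs ! i) (mset_set {..<length xs}) = mset xs"
    by (metis atLeast0LessThan map_nth mset_map mset_upt)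
  finally show ?thesis .
qed

lemma set_permute_word: "\<sigma> permutes {1..length xs} \<Longrightarrow> set (permute_word \<sigma> xs) = set xs"
  by (rule mset_eq_setD[OF mset_permute_word])

lemma permutes_inj_onI:
  assumes "finite S" "inj_on p S" "p ` S \<subseteq> S" "\<And>x. x \<notin> S \<Longrightarrow> p x = x"
  shows "p permutes S"
  using assms endo_inj_surj[of S p] by (intro bij_imp_permutes) (auto simp: bij_betw_def)

section \<open>Block permutations and their action on words\<close>

lemma block_perm_permutes:
  assumes \<sigma>: "\<sigma> permutes {1..n}" and \<rho>: "\<rho> permutes {1..m}"
  shows "block_perm n \<sigma> \<rho> permutes {1..n + m}"
proof (rule permutes_inj_onI)
  have \<sigma>_in: "\<sigma> i \<in> {1..n}" if "1 \<le> i" "i \<le> n" for i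
    using permutes_in_image[OF \<sigma>, of i] that by simp
  have \<rho>_in: "\<rho> (i - n) \<in> {1..m}" if "n < i" "i \<le> n + m" for i
    using permutes_in_image[OF \<rho>, of "i - n"] that by auto
  show "inj_on (block_perm n \<sigma> \<rho>) {1..n + m}"
  proof (rule inj_onI)
    fix i j assume ij: "i \<in> {1..n + m}" "j \<in> {1..n + m}" "block_perm n \<sigma> \<rho> i = block_perm n \<sigma> \<rho> j"
    show "i = j"
      using ij \<sigma>_in[of i] \<sigma>_in[of j] \<rho>_in[of i] \<rho>_in[of j]
        inj_eq[OF permutes_inj[OF \<sigma>], of i j] inj_eq[OF permutes_inj[OF \<rho>], of "i - n" "j - n"]
      by (auto simp: block_perm_def split: if_splits)
  qed
  show "block_perm n \<sigma> \<rho> ` {1..n + m} \<subseteq> {1..n + m}"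
  proof
    fix k assume "k \<in> block_perm n \<sigma> \<rho> ` {1..n + m}"
    then obtain i where "i \<in> {1..n + m}" "k = block_perm n \<sigma> \<rho> i" by blast
    then show "k \<in> {1..n + m}" using \<sigma>_in[of i] \<rho>_in[of i] by (auto simp: block_perm_def)
  qed
  show "block_perm n \<sigma> \<rho> i = i" if "i \<notin> {1..n + m}" for i
  proof (cases "i \<le> n")
    case True
    then show ?thesis using that permutes_not_in[OF \<sigma>, of i] by (auto simp: block_perm_def)
  next
    case False
    then have "i - n \<notin> {1..m}" using that by auto
    then show ?thesis using False permutes_not_in[OF \<rho>, of "i - n"] by (simp add: block_perm_def)
  qed
qed simp

lemma permute_word_block_perm:
  assumes \<sigma>: "\<sigma> permutes {1..length xs}" and \<rho>: "\<rho> permutes {1..length ys}"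
  shows "permute_word (block_perm (length xs) \<sigma> \<rho>) (xs @ ys) = permute_word \<sigma> xs @ permute_word \<rho> ys"
proof (rule permute_word_eqI)
  show "block_perm (length xs) \<sigma> \<rho> permutes {1..length (xs @ ys)}"
    using block_perm_permutes[OF \<sigma> \<rho>] by simp
  fix i assume i: "i < length (xs @ ys)"
  show "(permute_word \<sigma> xs @ permute_word \<rho> ys) ! (block_perm (length xs) \<sigma> \<rho> (Suc i) - 1)
      = (xs @ ys) ! i"
  proof (cases "i < length xs")
    case True
    then have "\<sigma> (Suc i) \<in> {1..length xs}" using permutes_in_image[OF \<sigma>] by simp
    then have "\<sigma> (Suc i) - 1 < length xs" by auto
    then show ?thesis
      using True nth_permute_word[OF \<sigma> True] by (simp add: block_perm_def nth_append)
  next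
    case False
    then obtain k where k: "i = length xs + k" "k < length ys"
      using i by (metis add_diff_inverse_nat length_append nat_add_left_cancel_less)
    then have "\<rho> (Suc k) \<in> {1..length ys}" using permutes_in_image[OF \<rho>] by simp
    then have "length xs + \<rho> (Suc k) - 1 = length xs + (\<rho> (Suc k) - 1)" by auto
    then show ?thesis
      using k nth_permute_word[OF \<rho> k(2)] by (simp add: block_perm_def nth_append)
  qed
qed simp

lemma block_swap_permutes: "block_swap n m permutes {1..n + m}"
  by (rule permutes_inj_onI) (auto simp: block_swap_def inj_on_def)

lemma permute_word_block_swap:
  "permute_word (block_swap (length xs) (length ys)) (ys @ xs) = xs @ ys"
proof (rule permute_word_eqI)
  show "block_swap (length xs) (length ys) permutes {1..length (ys @ xs)}"
    using block_swap_permutes[of "length xs" "length ys"] by (simp add: add.commute)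
  fix i assume i: "i < length (ys @ xs)"
  show "(xs @ ys) ! (block_swap (length xs) (length ys) (Suc i) - 1) = (ys @ xs) ! i"
  proof (cases "i < length ys")
    case True
    then have "block_swap (length xs) (length ys) (Suc i) = Suc (length xs + i)"
      by (simp add: block_swap_def)
    then show ?thesis using True by (simp add: nth_append)
  next
    case False
    then have "block_swap (length xs) (length ys) (Suc i) = Suc (i - length ys)"
      using i by (simp add: block_swap_def)
    moreover have "i - length ys < length xs" using False i by auto
    ultimately show ?thesis using False by (simp add: nth_append)
  qed
qed simp

text \<open>The cycle that sends place 1 to place \<open>p + 1\<close> and lowers the places 2 to
  \<open>p + 1\<close> by one. It is written with \<open>block_swap\<close> and
  \<open>block_perm\<close> so that twisted commutativity and equivariance apply to it
  directly.\<close>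

definition move_first :: "nat \<Rightarrow> nat \<Rightarrow> nat" where
  "move_first p = block_perm (Suc p) (block_swap p 1) id"

lemma move_first_permutes: "p < n \<Longrightarrow> move_first p permutes {1..n}"
  using block_perm_permutes[OF block_swap_permutes[of p 1] permutes_id[of "{1..n - Suc p}"]]
  by (simp add: move_first_def)

lemma permute_word_move_first:
  "permute_word (move_first (length xs)) (a # xs @ ys) = xs @ a # ys"
proof -
  have "block_swap (length xs) 1 permutes {1..length ([a] @ xs)}"
    using block_swap_permutes[of "length xs" 1] by simp
  from permute_word_block_perm[OF this, of id ys]
  have "permute_word (move_first (length xs)) (([a] @ xs) @ ys)
      = permute_word (block_swap (length xs) (length [a])) ([a] @ xs) @ permute_word id ys"
    by (simp add: move_first_def permutes_id)
  then show ?thesis unfolding permute_word_block_swap by simp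
qed

lemma permutes_fix_one:
  assumes \<tau>: "\<tau> permutes {1..Suc n}" and one: "\<tau> 1 = 1"
  obtains \<rho> where "\<rho> permutes {1..n}" "\<tau> = block_perm 1 id \<rho>"
proof
  define \<rho> where "\<rho> i = (if i = 0 then 0 else \<tau> (Suc i) - 1)" for i
  have gt: "1 < \<tau> (Suc i)" if "i \<noteq> 0" for i
  proof -
    have "\<tau> (Suc i) \<noteq> \<tau> 1" "\<tau> (Suc i) \<noteq> \<tau> 0"
      using that inj_eq[OF permutes_inj[OF \<tau>]] by auto
    then show ?thesis using one permutes_not_in[OF \<tau>, of 0] by simp
  qed
  show "\<tau> = block_perm 1 id \<rho>"
  proof
    fix i
    have "\<tau> 0 = 0" using permutes_not_in[OF \<tau>, of 0] by simp
    moreover have "\<tau> i = Suc (\<rho> (i - 1))" if "1 < i"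
      using gt[of "i - 1"] that by (simp add: \<rho>_def)
    ultimately show "\<tau> i = block_perm 1 id \<rho> i"
      using one by (cases "i = 0"; cases "i = 1") (auto simp: block_perm_def)
  qed
  show "\<rho> permutes {1..n}"
  proof (rule permutes_inj_onI)
    show "inj_on \<rho> {1..n}"
    proof (rule inj_onI)
      fix i j assume "i \<in> {1..n}" "j \<in> {1..n}" "\<rho> i = \<rho> j"
      then have "\<tau> (Suc i) = \<tau> (Suc j)" using gt[of i] gt[of j] by (simp add: \<rho>_def)
      then show "i = j" using inj_eq[OF permutes_inj[OF \<tau>]] by simp
    qed
    show "\<rho> ` {1..n} \<subseteq> {1..n}"
    proof
      fix k assume "k \<in> \<rho> ` {1..n}"
      then obtain i where i: "i \<in> {1..n}" "k = \<rho> i" by auto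
      then show "k \<in> {1..n}"
        using gt[of i] permutes_in_image[OF \<tau>, of "Suc i"] by (auto simp: \<rho>_def)
    qed
    show "\<rho> i = i" if "i \<notin> {1..n}" for i
      using that permutes_not_in[OF \<tau>, of "Suc i"] by (auto simp: \<rho>_def)
  qed simp
qed

text \<open>Take \<open>p\<close> from \<open>\<pi> 1 = Suc p\<close>; undoing
  \<open>move_first p\<close> leaves a permutation that fixes 1. This coset decomposition is the
  induction step for the action on monomials: one factor is handled by equivariance, the other by
  twisted commutativity.\<close>

lemma permutes_move_first_decomp:
  assumes \<pi>: "\<pi> permutes {1..Suc n}"
  obtains p \<rho> where "p \<le> n" "\<rho> permutes {1..n}" "\<pi> = move_first p \<circ> block_perm 1 id \<rho>"
proof -
  define p where "p = \<pi> 1 - 1"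
  have "\<pi> 1 \<in> {1..Suc n}" using permutes_in_image[OF \<pi>] by simp
  then have p: "p \<le> n" "\<pi> 1 = Suc p" by (auto simp: p_def)
  have mf: "move_first p permutes {1..Suc n}" using p by (intro move_first_permutes) simp
  define \<tau> where "\<tau> = inv' (move_first p) \<circ> \<pi>"
  have \<tau>: "\<tau> permutes {1..Suc n}"
    unfolding \<tau>_def using permutes_compose[OF \<pi> permutes_inv[OF mf]] .
  have "move_first p 1 = Suc p" by (simp add: move_first_def block_perm_def block_swap_def)
  then have "\<tau> 1 = 1" using p permutes_inverses(2)[OF mf, of 1] by (simp add: \<tau>_def)
  from permutes_fix_one[OF \<tau> this] obtain \<rho> where
    "\<rho> permutes {1..n}" "\<tau> = block_perm 1 id \<rho>" .
  moreover have "\<pi> = move_first p \<circ> \<tau>"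
    using permutes_inverses(1)[OF mf] by (auto simp: \<tau>_def)
  ultimately show ?thesis using that p by blast
qed

lemma permutes_eq_block_perm:
  assumes "\<pi> permutes {1..n}" shows "block_perm n \<pi> id = \<pi>"
  using permutes_not_in[OF assms] by (auto simp: block_perm_def fun_eq_iff)

text \<open>Each letter of \<open>zs\<close> occurs exactly once in \<open>ys @ zs\<close>, so its
  place there is determined and \<open>\<pi>\<close> must fix all places of the tail.\<close>

lemma permute_word_append_fix:
  assumes \<pi>: "\<pi> permutes {1..length (xs @ zs)}" and "permute_word \<pi> (xs @ zs) = ys @ zs"
    and "distinct zs" "set ys \<inter> set zs = {}"
  shows "\<pi> permutes {1..length xs}" "permute_word \<pi> xs = ys"
proof -
  have len: "length ys = length xs"
    using arg_cong[OF assms(2), of length] by simp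
  have fixed: "\<pi> (Suc i) = Suc i" if i: "length xs \<le> i" "i < length (xs @ zs)" for i
  proof -
    define k where "k = \<pi> (Suc i) - 1"
    have k: "\<pi> (Suc i) = Suc k" "k < length (xs @ zs)"
      using permutes_in_image[OF \<pi>, of "Suc i"] i unfolding k_def by auto
    have eq: "(ys @ zs) ! k = zs ! (i - length xs)"
      using nth_permute_word[OF \<pi> i(2)] i assms(2) by (simp add: nth_append k_def)
    have "zs ! (i - length xs) \<in> set zs" using i by simp
    then have "\<not> k < length xs"
      using assms(4) eq len nth_mem[of k ys] by (metis IntI empty_iff nth_append)
    then have "k - length xs = i - length xs"
      using eq len k i assms(3) by (simp add: nth_append nth_eq_iff_index_eq)
    then show ?thesis using k i \<open>\<not> k < length xs\<close> by simp
  qed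
  have "\<pi> x = x" if "x \<in> {1..length (xs @ zs)} - {1..length xs}" for x
    using fixed[of "x - 1"] that by auto
  then show *: "\<pi> permutes {1..length xs}" using permutes_superset[OF \<pi>] by blast
  have "permute_word \<pi> (xs @ zs) = permute_word \<pi> xs @ zs"
    using permute_word_block_perm[OF *, of id zs] permutes_eq_block_perm[OF *]
    by (simp add: permutes_id)
  then show "permute_word \<pi> xs = ys" using assms(2) by simp
qed

section \<open>Linear spans and graded modules\<close>

lemma (in cring) ideal_by_closureI:
  assumes "I \<subseteq> carrier R" "\<zero> \<in> I"
    and "\<And>a b. \<lbrakk>a \<in> I; b \<in> I\<rbrakk> \<Longrightarrow> a \<oplus> b \<in> I"
    and smult: "\<And>a b. \<lbrakk>a \<in> I; b \<in> carrier R\<rbrakk> \<Longrightarrow> b \<otimes> a \<in> I"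
  shows "ideal I R"
proof (rule idealI[OF ring_axioms])
  show "subgroup I (add_monoid R)"
  proof (rule add.subgroupI)
    fix a assume a: "a \<in> I"
    then have "\<ominus> \<one> \<otimes> a = \<ominus> a" using assms(1) l_minus[of \<one> a] by auto
    then show "\<ominus> a \<in> I" using smult[OF a, of "\<ominus> \<one>"] by simp
  qed (use assms in auto)
  show "a \<otimes> x \<in> I" if "a \<in> I" "x \<in> carrier R" for a x
    using smult[OF that] m_comm[of a x] assms(1) that by auto
qed (rule smult)

definition lspan :: "('k, 'r) ring_scheme \<Rightarrow> ('k, 'm, 'z) module_scheme \<Rightarrow> 'm set \<Rightarrow> 'm set" where
  "lspan R M X = \<Inter>{N. submodule N R M \<and> X \<subseteq> N}"

context module
begin

lemma submodule_by_smultI: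
  assumes "H \<subseteq> carrier M" "\<zero>\<^bsub>M\<^esub> \<in> H"
    and "\<And>x y. \<lbrakk>x \<in> H; y \<in> H\<rbrakk> \<Longrightarrow> x \<oplus>\<^bsub>M\<^esub> y \<in> H"
    and "\<And>a x. \<lbrakk>a \<in> carrier R; x \<in> H\<rbrakk> \<Longrightarrow> a \<odot>\<^bsub>M\<^esub> x \<in> H"
  shows "submodule H R M"
proof (rule submoduleI)
  fix x assume x: "x \<in> H"
  then have "\<ominus>\<^bsub>M\<^esub> x = (\<ominus> \<one>) \<odot>\<^bsub>M\<^esub> x"
    using assms(1) smult_l_minus[of \<one> x] by auto
  then show "\<ominus>\<^bsub>M\<^esub> x \<in> H" using assms(4)[of "\<ominus> \<one>" x] x by simp
qed (use assms in auto)

lemma submodule_zero: "submodule H R M \<Longrightarrow> \<zero>\<^bsub>M\<^esub> \<in> H"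
  using submoduleE(2,4)[of H] submoduleE(1)[of H] smult_l_null R.zero_closed
  by (metis equals0I subsetD)

lemma submodule_minus:
  "\<lbrakk>submodule H R M; x \<in> H; y \<in> H\<rbrakk> \<Longrightarrow> x \<ominus>\<^bsub>M\<^esub> y \<in> H"
  unfolding a_minus_def using submoduleE(3,5)[of H] by blast

lemma submodule_finsum:
  assumes "submodule H R M" "\<And>i. i \<in> I \<Longrightarrow> f i \<in> H"
  shows "finsum M f I \<in> H"
  using assms(2)
proof (induction I rule: infinite_finite_induct)
  case (insert i I)
  then have "f \<in> I \<rightarrow> carrier M" "f i \<in> carrier M"
    using submoduleE(1)[OF assms(1)] by auto
  then show ?case using insert submoduleE(5)[OF assms(1)] by simp
qed (simp_all add: submodule_zero[OF assms(1)])

lemma lspan_submodule: "X \<subseteq> carrier M \<Longrightarrow> submodule (lspan R M X) R M"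
proof (rule submodule_by_smultI)
  assume "X \<subseteq> carrier M"
  then show "lspan R M X \<subseteq> carrier M"
    unfolding lspan_def using carrier_is_submodule by blast
qed (auto simp: lspan_def submodule_zero submoduleE(4,5))

lemma lspan_superset: "X \<subseteq> lspan R M X"
  unfolding lspan_def by blast

lemma lspan_least: "\<lbrakk>submodule N R M; X \<subseteq> N\<rbrakk> \<Longrightarrow> lspan R M X \<subseteq> N"
  unfolding lspan_def by blast

lemma lspan_mono: "X \<subseteq> Y \<Longrightarrow> lspan R M X \<subseteq> lspan R M Y"
  unfolding lspan_def by blast

lemma zero_submodule: "submodule {\<zero>\<^bsub>M\<^esub>} R M"
  by (rule submodule_by_smultI) auto

text \<open>Used to split off the term at the largest word. The elements of the stated form already
  make up a submodule that contains the generators.\<close>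

lemma lspan_insertE:
  assumes "y \<in> lspan R M (insert x X)" "x \<in> carrier M" "X \<subseteq> carrier M"
  obtains a l where "a \<in> carrier R" "l \<in> lspan R M X" "y = a \<odot>\<^bsub>M\<^esub> x \<oplus>\<^bsub>M\<^esub> l"
proof -
  define H where "H = {a \<odot>\<^bsub>M\<^esub> x \<oplus>\<^bsub>M\<^esub> l | a l. a \<in> carrier R \<and> l \<in> lspan R M X}"
  note sub = lspan_submodule[OF assms(3)]
  have l_carrier: "l \<in> carrier M" if "l \<in> lspan R M X" for l
    using submoduleE(1)[OF sub] that by blast
  have H: "a \<odot>\<^bsub>M\<^esub> x \<oplus>\<^bsub>M\<^esub> l \<in> H" if "a \<in> carrier R" "l \<in> lspan R M X" for a l
    using that unfolding H_def by blast
  have "submodule H R M"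
  proof (rule submodule_by_smultI)
    show "H \<subseteq> carrier M" using assms(2) l_carrier by (auto simp: H_def)
    show "\<zero>\<^bsub>M\<^esub> \<in> H" using H[of \<zero> "\<zero>\<^bsub>M\<^esub>"] submodule_zero[OF sub] assms(2) by simp
    fix u assume "u \<in> H"
    then obtain a l where u: "u = a \<odot>\<^bsub>M\<^esub> x \<oplus>\<^bsub>M\<^esub> l" "a \<in> carrier R" "l \<in> lspan R M X"
      unfolding H_def by blast
    show "u \<oplus>\<^bsub>M\<^esub> v \<in> H" if "v \<in> H" for v
    proof -
      from that obtain b m where v: "v = b \<odot>\<^bsub>M\<^esub> x \<oplus>\<^bsub>M\<^esub> m" "b \<in> carrier R" "m \<in> lspan R M X"
        unfolding H_def by blast
      have "u \<oplus>\<^bsub>M\<^esub> v = (a \<oplus> b) \<odot>\<^bsub>M\<^esub> x \<oplus>\<^bsub>M\<^esub> (l \<oplus>\<^bsub>M\<^esub> m)"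
        using u v assms(2) l_carrier by (simp add: smult_l_distr M.add.m_ac)
      then show ?thesis using H[of "a \<oplus> b" "l \<oplus>\<^bsub>M\<^esub> m"] u v submoduleE(5)[OF sub] by simp
    qed
    show "b \<odot>\<^bsub>M\<^esub> u \<in> H" if "b \<in> carrier R" for b
    proof -
      have "b \<odot>\<^bsub>M\<^esub> u = (b \<otimes> a) \<odot>\<^bsub>M\<^esub> x \<oplus>\<^bsub>M\<^esub> b \<odot>\<^bsub>M\<^esub> l"
        using u that assms(2) l_carrier by (simp add: smult_r_distr smult_assoc1)
      then show ?thesis using H[of "b \<otimes> a" "b \<odot>\<^bsub>M\<^esub> l"] u that submoduleE(4)[OF sub] by simp
    qed
  qed
  moreover have "insert x X \<subseteq> H"
  proof
    fix z assume "z \<in> insert x X"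
    then consider "z = x" | "z \<in> X" by blast
    then show "z \<in> H"
    proof cases
      case 1
      then show ?thesis
        using H[of \<one> "\<zero>\<^bsub>M\<^esub>"] submodule_zero[OF sub] assms(2) by simp
    next
      case 2
      then show ?thesis
        using H[of \<zero> z] lspan_superset[of X] assms(2) l_carrier[of z] by auto
    qed
  qed
  ultimately show ?thesis using lspan_least assms(1) that unfolding H_def by blast
qed

lemma lspan_base: "x \<in> X \<Longrightarrow> x \<in> lspan R M X"
  using lspan_superset by blast

end

text \<open>Linearity is asked for on \<open>G\<close> alone because the maps in question involve
  \<open>perm_act\<close>, which is controlled only on a single graded part.\<close>

lemma submodule_linear_preimage:
  assumes M: "module R M" and M': "module R M'"
    and G: "submodule G R M" and N: "submodule N R M'"
    and add: "\<And>x y. \<lbrakk>x \<in> G; y \<in> G\<rbrakk> \<Longrightarrow> \<phi> (x \<oplus>\<^bsub>M\<^esub> y) = \<phi> x \<oplus>\<^bsub>M'\<^esub> \<phi> y"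
    and smult: "\<And>a x. \<lbrakk>a \<in> carrier R; x \<in> G\<rbrakk> \<Longrightarrow> \<phi> (a \<odot>\<^bsub>M\<^esub> x) = a \<odot>\<^bsub>M'\<^esub> \<phi> x"
    and closed: "\<And>x. x \<in> G \<Longrightarrow> \<phi> x \<in> carrier M'"
  shows "submodule {x \<in> G. \<phi> x \<in> N} R M"
proof (rule module.submodule_by_smultI[OF M])
  interpret M: module R M by (rule M)
  interpret M': module R M' by (rule M')
  note GE = M.submoduleE[OF G] and NE = M'.submoduleE[OF N]
  have z: "\<zero>\<^bsub>M\<^esub> \<in> G" by (rule M.submodule_zero[OF G])
  have "\<phi> \<zero>\<^bsub>M\<^esub> = \<zero>\<^bsub>M'\<^esub>"
    using smult[of "\<zero>\<^bsub>R\<^esub>" "\<zero>\<^bsub>M\<^esub>"] z closed[OF z] by simp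
  then show "\<zero>\<^bsub>M\<^esub> \<in> {x \<in> G. \<phi> x \<in> N}" using z M'.submodule_zero[OF N] by simp
  show "{x \<in> G. \<phi> x \<in> N} \<subseteq> carrier M" using GE(1) by blast
  show "x \<oplus>\<^bsub>M\<^esub> y \<in> {x \<in> G. \<phi> x \<in> N}" if "x \<in> {x \<in> G. \<phi> x \<in> N}" "y \<in> {x \<in> G. \<phi> x \<in> N}" for x y
    using that add GE(5) NE(5) by simp
  show "a \<odot>\<^bsub>M\<^esub> x \<in> {x \<in> G. \<phi> x \<in> N}" if "a \<in> carrier R" "x \<in> {x \<in> G. \<phi> x \<in> N}" for a x
    using that smult GE(4) NE(4) by simp
qed

lemma linear_image_lspan:
  assumes M: "module R M" and M': "module R M'"
    and G: "submodule G R M" and N: "submodule N R M'" and XG: "X \<subseteq> G"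
    and add: "\<And>x y. \<lbrakk>x \<in> G; y \<in> G\<rbrakk> \<Longrightarrow> \<phi> (x \<oplus>\<^bsub>M\<^esub> y) = \<phi> x \<oplus>\<^bsub>M'\<^esub> \<phi> y"
    and smult: "\<And>a x. \<lbrakk>a \<in> carrier R; x \<in> G\<rbrakk> \<Longrightarrow> \<phi> (a \<odot>\<^bsub>M\<^esub> x) = a \<odot>\<^bsub>M'\<^esub> \<phi> x"
    and closed: "\<And>x. x \<in> G \<Longrightarrow> \<phi> x \<in> carrier M'"
    and XN: "\<And>x. x \<in> X \<Longrightarrow> \<phi> x \<in> N" and x: "x \<in> lspan R M X"
  shows "\<phi> x \<in> N"
  using module.lspan_least[OF M submodule_linear_preimage[OF M M' G N add smult closed], of X]
    XG XN x by blast

text \<open>Linearity in the second argument is used first, with a generator in the first; then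
  linearity in the first with \<open>y\<close> fixed.\<close>

lemma bilinear_lspan:
  assumes L: "module R L" and M: "module R M" and T: "submodule T R M"
    and closed: "\<And>x y. \<lbrakk>x \<in> carrier L; y \<in> carrier M\<rbrakk> \<Longrightarrow> \<beta> x y \<in> carrier M"
    and add_l: "\<And>x x' y. \<lbrakk>x \<in> carrier L; x' \<in> carrier L; y \<in> carrier M\<rbrakk> \<Longrightarrow>
      \<beta> (x \<oplus>\<^bsub>L\<^esub> x') y = \<beta> x y \<oplus>\<^bsub>M\<^esub> \<beta> x' y"
    and add_r: "\<And>x y y'. \<lbrakk>x \<in> carrier L; y \<in> carrier M; y' \<in> carrier M\<rbrakk> \<Longrightarrow>
      \<beta> x (y \<oplus>\<^bsub>M\<^esub> y') = \<beta> x y \<oplus>\<^bsub>M\<^esub> \<beta> x y'"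
    and smult_l: "\<And>a x y. \<lbrakk>a \<in> carrier R; x \<in> carrier L; y \<in> carrier M\<rbrakk> \<Longrightarrow>
      \<beta> (a \<odot>\<^bsub>L\<^esub> x) y = a \<odot>\<^bsub>M\<^esub> \<beta> x y"
    and smult_r: "\<And>a x y. \<lbrakk>a \<in> carrier R; x \<in> carrier L; y \<in> carrier M\<rbrakk> \<Longrightarrow>
      \<beta> x (a \<odot>\<^bsub>M\<^esub> y) = a \<odot>\<^bsub>M\<^esub> \<beta> x y"
    and X: "X \<subseteq> carrier L" and Y: "Y \<subseteq> carrier M"
    and gens: "\<And>x y. \<lbrakk>x \<in> X; y \<in> Y\<rbrakk> \<Longrightarrow> \<beta> x y \<in> T"
    and x: "x \<in> lspan R L X" and y: "y \<in> lspan R M Y"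
  shows "\<beta> x y \<in> T"
proof -
  have y_in: "y \<in> carrier M"
    using y module.lspan_least[OF M module.carrier_is_submodule[OF M] Y] by blast
  have right: "\<beta> x' y \<in> T" if x': "x' \<in> X" for x'
  proof (rule linear_image_lspan[OF M M module.carrier_is_submodule[OF M] T Y, where \<phi> = "\<beta> x'"])
    have "x' \<in> carrier L" using x' X by blast
    then show "\<And>u v. \<lbrakk>u \<in> carrier M; v \<in> carrier M\<rbrakk> \<Longrightarrow> \<beta> x' (u \<oplus>\<^bsub>M\<^esub> v) = \<beta> x' u \<oplus>\<^bsub>M\<^esub> \<beta> x' v"
      and "\<And>a u. \<lbrakk>a \<in> carrier R; u \<in> carrier M\<rbrakk> \<Longrightarrow> \<beta> x' (a \<odot>\<^bsub>M\<^esub> u) = a \<odot>\<^bsub>M\<^esub> \<beta> x' u"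
      and "\<And>u. u \<in> carrier M \<Longrightarrow> \<beta> x' u \<in> carrier M"
      using add_r smult_r closed by blast+
    show "\<And>u. u \<in> Y \<Longrightarrow> \<beta> x' u \<in> T" using gens x' by blast
  qed (rule y)
  show ?thesis
    using linear_image_lspan[OF L M module.carrier_is_submodule[OF L] T X, where \<phi> = "\<lambda>x. \<beta> x y"]
      add_l smult_l closed right x y_in by blast
qed

section \<open>Submodules assembled degree by degree\<close>

context graded_sym_module
begin

lemma grade_carrier: "x \<in> grade M n \<Longrightarrow> x \<in> carrier M"
  using submoduleE(1)[OF grade_submodule] by blast

lemmas grade_add = submoduleE(5)[OF grade_submodule]
  and grade_smult = submoduleE(4)[OF grade_submodule]
  and grade_zero = submodule_zero[OF grade_submodule]

lemma perm_closed:
  assumes "\<sigma> permutes {1..n}" "x \<in> grade M n"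
  shows "perm_act M n \<sigma> x \<in> grade M n"
  using group_action.element_image[OF perm_group_action, of \<sigma> n x] assms
  by (simp add: sym_group_carrier)

lemma perm_id:
  assumes "x \<in> grade M n"
  shows "perm_act M n id x = x"
  using fun_cong[OF group_action.id_eq_one[OF perm_group_action], of n x] assms
  by (simp add: sym_group_one)

lemma perm_comp:
  assumes "\<sigma> permutes {1..n}" "\<rho> permutes {1..n}" "x \<in> grade M n"
  shows "perm_act M n (\<sigma> \<circ> \<rho>) x = perm_act M n \<sigma> (perm_act M n \<rho> x)"
  using group_action.composition_rule[OF perm_group_action, of x n \<sigma> \<rho>] assms
    perm_closed[OF assms(2,3)]
  by (simp add: sym_group_carrier sym_group_mult)

lemmas perm_add' = perm_add[unfolded sym_group_carrier]
  and perm_smult' = perm_smult[unfolded sym_group_carrier]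

lemma homogeneous_components_unique:
  assumes "homogeneous_components M x c" "homogeneous_components M x c'"
  shows "c = c'"
proof -
  have "finsum M c {n. c n \<noteq> \<zero>\<^bsub>M\<^esub>} \<in> carrier M"
    using assms(1) grade_carrier unfolding homogeneous_components_def
    by (intro M.finsum_closed) auto
  then have "x \<in> carrier M"
    using assms(1) unfolding homogeneous_components_def by simp
  from direct_sum[OF this] show ?thesis using assms by blast
qed

text \<open>Replaces the exact support by any finite set containing it. Two elements can then be
  added over a common index set, even when components cancel.\<close>

lemma homogeneous_components_iff:
  "homogeneous_components M x c \<longleftrightarrow>
    (\<forall>n. c n \<in> grade M n) \<and> (\<exists>S. finite S \<and> (\<forall>n. n \<notin> S \<longrightarrow> c n = \<zero>\<^bsub>M\<^esub>) \<and> x = finsum M c S)"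
proof -
  have eq: "finsum M c {n. c n \<noteq> \<zero>\<^bsub>M\<^esub>} = finsum M c S"
    if "\<forall>n. c n \<in> grade M n" "finite S" "\<forall>n. n \<notin> S \<longrightarrow> c n = \<zero>\<^bsub>M\<^esub>" for S
    using that grade_carrier by (intro M.add.finprod_mono_neutral_cong_left) auto
  show ?thesis
  proof
    assume "homogeneous_components M x c"
    then show "(\<forall>n. c n \<in> grade M n) \<and>
        (\<exists>S. finite S \<and> (\<forall>n. n \<notin> S \<longrightarrow> c n = \<zero>\<^bsub>M\<^esub>) \<and> x = finsum M c S)"
      unfolding homogeneous_components_def by blast
  next
    assume *: "(\<forall>n. c n \<in> grade M n) \<and>
        (\<exists>S. finite S \<and> (\<forall>n. n \<notin> S \<longrightarrow> c n = \<zero>\<^bsub>M\<^esub>) \<and> x = finsum M c S)"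
    then obtain S where S: "finite S" "\<forall>n. n \<notin> S \<longrightarrow> c n = \<zero>\<^bsub>M\<^esub>" "x = finsum M c S" by blast
    then have "finite {n. c n \<noteq> \<zero>\<^bsub>M\<^esub>}" by (auto intro: finite_subset[of _ S])
    then show "homogeneous_components M x c"
      unfolding homogeneous_components_def using * S eq[of S] by simp
  qed
qed

lemma homogeneous_components_grade:
  assumes "x \<in> grade M n"
  shows "homogeneous_components M x (\<lambda>k. if k = n then x else \<zero>\<^bsub>M\<^esub>)"
  unfolding homogeneous_components_iff
  using assms grade_zero grade_carrier[OF assms]
  by (auto intro!: exI[of _ "{n}"])

text \<open>The internal direct sum of the \<open>P n\<close>, described through components so that
  closure under taking components comes from their uniqueness.\<close>

definition total :: "(nat \<Rightarrow> 'm set) \<Rightarrow> 'm set" where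
  "total P = {x. \<exists>c. homogeneous_components M x c \<and> (\<forall>n. c n \<in> P n)}"

lemma total_least:
  assumes "submodule N R M" "\<And>n. P n \<subseteq> N"
  shows "total P \<subseteq> N"
proof
  fix x assume "x \<in> total P"
  then obtain c where "x = finsum M c {n. c n \<noteq> \<zero>\<^bsub>M\<^esub>}" "\<forall>n. c n \<in> P n"
    unfolding total_def homogeneous_components_def by blast
  then show "x \<in> N" using submodule_finsum[OF assms(1), of _ c] assms(2) by blast
qed

context
  fixes P :: "nat \<Rightarrow> 'm set"
  assumes P: "submodule (P n) R M" and P_grade: "P n \<subseteq> grade M n"
begin

lemma total_submodule: "submodule (total P) R M"
proof (rule submodule_by_smultI)
  show "total P \<subseteq> carrier M"
    using carrier_is_submodule P_grade grade_carrier by (intro total_least) auto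
  have "homogeneous_components M \<zero>\<^bsub>M\<^esub> (\<lambda>_. \<zero>\<^bsub>M\<^esub>)"
    unfolding homogeneous_components_iff using grade_zero by (auto intro!: exI[of _ "{}"])
  then show "\<zero>\<^bsub>M\<^esub> \<in> total P"
    unfolding total_def using submodule_zero[OF P] by blast
next
  fix x y assume "x \<in> total P" "y \<in> total P"
  then obtain c c' where c: "homogeneous_components M x c" "\<forall>n. c n \<in> P n"
    and c': "homogeneous_components M y c'" "\<forall>n. c' n \<in> P n"
    unfolding total_def by blast
  from c(1) obtain S where S: "\<forall>n. c n \<in> grade M n" "finite S" "\<forall>n. n \<notin> S \<longrightarrow> c n = \<zero>\<^bsub>M\<^esub>"
      "x = finsum M c S"
    unfolding homogeneous_components_iff by blast
  from c'(1) obtain S' where S': "\<forall>n. c' n \<in> grade M n" "finite S'"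
      "\<forall>n. n \<notin> S' \<longrightarrow> c' n = \<zero>\<^bsub>M\<^esub>" "y = finsum M c' S'"
    unfolding homogeneous_components_iff by blast
  have car: "c \<in> I \<rightarrow> carrier M" "c' \<in> I \<rightarrow> carrier M" for I
    using S(1) S'(1) grade_carrier by auto
  have "x = finsum M c (S \<union> S')"
    unfolding S(4) using S S' car by (intro M.add.finprod_mono_neutral_cong_left) auto
  moreover have "y = finsum M c' (S \<union> S')"
    unfolding S'(4) using S S' car by (intro M.add.finprod_mono_neutral_cong_left) auto
  ultimately have "x \<oplus>\<^bsub>M\<^esub> y = finsum M (\<lambda>n. c n \<oplus>\<^bsub>M\<^esub> c' n) (S \<union> S')"
    using M.finsum_addf[OF car, of "S \<union> S'"] by simp
  then have "homogeneous_components M (x \<oplus>\<^bsub>M\<^esub> y) (\<lambda>n. c n \<oplus>\<^bsub>M\<^esub> c' n)"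
    unfolding homogeneous_components_iff using S S' grade_add
    by (auto intro!: exI[of _ "S \<union> S'"])
  then show "x \<oplus>\<^bsub>M\<^esub> y \<in> total P"
    unfolding total_def using c(2) c'(2) submoduleE(5)[OF P] by blast
next
  fix a x assume a: "a \<in> carrier R" and "x \<in> total P"
  then obtain c where c: "homogeneous_components M x c" "\<forall>n. c n \<in> P n"
    unfolding total_def by blast
  from c(1) obtain S where S: "\<forall>n. c n \<in> grade M n" "finite S" "\<forall>n. n \<notin> S \<longrightarrow> c n = \<zero>\<^bsub>M\<^esub>"
      "x = finsum M c S"
    unfolding homogeneous_components_iff by blast
  then have "a \<odot>\<^bsub>M\<^esub> x = finsum M (\<lambda>n. a \<odot>\<^bsub>M\<^esub> c n) S"
    using finsum_smult_ldistr[OF S(2) a, of c] grade_carrier by auto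
  then have "homogeneous_components M (a \<odot>\<^bsub>M\<^esub> x) (\<lambda>n. a \<odot>\<^bsub>M\<^esub> c n)"
    unfolding homogeneous_components_iff using S a grade_smult
    by (auto intro!: exI[of _ S])
  then show "a \<odot>\<^bsub>M\<^esub> x \<in> total P"
    unfolding total_def using c(2) a submoduleE(4)[OF P] by blast
qed

lemma total_superset: "P n \<subseteq> total P"
proof
  fix x assume x: "x \<in> P n"
  show "x \<in> total P"
    unfolding total_def using homogeneous_components_grade[of x n] x P_grade submodule_zero[OF P]
    by (auto intro!: exI[of _ "\<lambda>k. if k = n then x else \<zero>\<^bsub>M\<^esub>"])
qed

text \<open>A homogeneous element has only one decomposition, the one concentrated in its degree.
  This turns a statement about the whole module back into one about each degree.\<close>

lemma total_grade:
  assumes "x \<in> total P" "x \<in> grade M n"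
  shows "x \<in> P n"
proof -
  obtain c where "homogeneous_components M x c" "\<forall>n. c n \<in> P n"
    using assms(1) unfolding total_def by blast
  moreover from this(1) have "c = (\<lambda>k. if k = n then x else \<zero>\<^bsub>M\<^esub>)"
    by (rule homogeneous_components_unique[OF _ homogeneous_components_grade[OF assms(2)]])
  ultimately show ?thesis by (metis (full_types))
qed

lemma total_graded_stable:
  assumes "\<And>n \<sigma> x. \<lbrakk>\<sigma> permutes {1..n}; x \<in> P n\<rbrakk> \<Longrightarrow> perm_act M n \<sigma> x \<in> P n"
  shows "graded_stable M (total P)"
  unfolding graded_stable_def
proof (intro conjI ballI allI impI)
  fix x c n assume "x \<in> total P" "homogeneous_components M x c"
  then have "c n \<in> P n"
    unfolding total_def using homogeneous_components_unique[of x c] by blast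
  then show "c n \<in> total P" using total_superset by blast
next
  fix n \<sigma> x assume "\<sigma> \<in> carrier (sym_group n)" "x \<in> total P \<inter> grade M n"
  then have "perm_act M n \<sigma> x \<in> P n"
    using total_grade assms by (auto simp: sym_group_carrier)
  then show "perm_act M n \<sigma> x \<in> total P" using total_superset by blast
qed

end

end

section \<open>Algebras generated in degree one\<close>

locale degree_one_tca = twisted_comm_algebra R A
  for R :: "('k, 'r) ring_scheme" and A :: "('k, 'a) sym_module" +
  fixes s :: "nat \<Rightarrow> 'a" and d :: nat
  assumes s_grade: "c < d \<Longrightarrow> s c \<in> grade A 1"
    and A_gen: "tca_generated R A (s ` {..<d}) = carrier A"
begin

definition monomial :: "nat list \<Rightarrow> 'a" where
  "monomial cs = foldr (\<lambda>c y. s c \<otimes>\<^bsub>A\<^esub> y) cs \<one>\<^bsub>A\<^esub>"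

lemma ring_A: "ring A" and module_A: "module R A"
  using twisted_comm_algebra_axioms
  by (simp_all add: twisted_comm_algebra_def graded_sym_module_def)

lemmas mult_assoc = monoid.m_assoc[OF ring.is_monoid[OF ring_A]]
  and mult_one_left = monoid.l_one[OF ring.is_monoid[OF ring_A]]
  and mult_one_right = monoid.r_one[OF ring.is_monoid[OF ring_A]]

lemma monomial_Nil [simp]: "monomial [] = \<one>\<^bsub>A\<^esub>"
  and monomial_Cons [simp]: "monomial (c # cs) = s c \<otimes>\<^bsub>A\<^esub> monomial cs"
  by (simp_all add: monomial_def)

lemma monomial_grade: "set cs \<subseteq> {..<d} \<Longrightarrow> monomial cs \<in> grade A (length cs)"
proof (induction cs)
  case (Cons c cs)
  then show ?case using mult_grade[OF s_grade[of c], of "monomial cs" "length cs"] by simp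
qed (simp add: one_grade)

lemma monomial_append:
  assumes "set cs \<subseteq> {..<d}" "set cs' \<subseteq> {..<d}"
  shows "monomial (cs @ cs') = monomial cs \<otimes>\<^bsub>A\<^esub> monomial cs'"
  using assms(1)
proof (induction cs)
  case Nil
  then show ?case
    using mult_one_left grade_carrier[OF monomial_grade[OF assms(2)]] by simp
next
  case (Cons c cs)
  then have "s c \<in> carrier A" "monomial cs \<in> carrier A" "monomial cs' \<in> carrier A"
    using grade_carrier s_grade monomial_grade assms(2) by auto
  then show ?case using Cons mult_assoc by simp
qed

text \<open>Twisted commutativity enters here: the permutation swaps the factor \<open>s a\<close>
  with the block \<open>monomial pre\<close>, while equivariance leaves \<open>monomial post\<close>
  alone.\<close>

lemma perm_move_first_monomial:
  assumes "a < d" "set pre \<subseteq> {..<d}" "set post \<subseteq> {..<d}"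
  shows "perm_act A (length (a # pre @ post)) (move_first (length pre)) (monomial (a # pre @ post))
    = monomial (pre @ a # post)"
proof -
  note mono_pre = monomial_grade[OF assms(2)] and mono_post = monomial_grade[OF assms(3)]
  have grade_pre: "s a \<otimes>\<^bsub>A\<^esub> monomial pre \<in> grade A (Suc (length pre))"
    using mult_grade[OF s_grade[OF assms(1)] mono_pre] by simp
  have "perm_act A (Suc (length pre) + length post) (move_first (length pre))
        ((s a \<otimes>\<^bsub>A\<^esub> monomial pre) \<otimes>\<^bsub>A\<^esub> monomial post)
      = perm_act A (Suc (length pre)) (block_swap (length pre) 1) (s a \<otimes>\<^bsub>A\<^esub> monomial pre)
        \<otimes>\<^bsub>A\<^esub> perm_act A (length post) id (monomial post)"
    unfolding move_first_def
    using block_swap_permutes[of "length pre" 1] grade_pre mono_post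
    by (intro mult_equivariant) (simp_all add: sym_group_carrier permutes_id)
  also have "\<dots> = (monomial pre \<otimes>\<^bsub>A\<^esub> s a) \<otimes>\<^bsub>A\<^esub> monomial post"
    using twisted_comm[OF mono_pre s_grade[OF assms(1)]] perm_id[OF mono_post] by simp
  finally show ?thesis
    using assms monomial_append[of pre "a # post"] monomial_append[of pre post]
      mult_assoc grade_carrier[OF mono_pre] grade_carrier[OF mono_post]
      grade_carrier[OF s_grade[OF assms(1)]] by simp
qed

text \<open>Induction on the word with the decomposition of \<open>\<pi>\<close>: equivariance and
  the induction hypothesis permute all letters but the first, and \<open>move_first\<close> then
  carries the first letter to its place.\<close>

lemma perm_monomial:
  assumes "set cs \<subseteq> {..<d}" "\<pi> permutes {1..length cs}"
  shows "perm_act A (length cs) \<pi> (monomial cs) = monomial (permute_word \<pi> cs)"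
  using assms
proof (induction cs arbitrary: \<pi>)
  case Nil
  then have "\<pi> = id" by (simp add: permutes_empty)
  then show ?case using perm_id[OF one_grade] by (simp add: permute_word_def id_def)
next
  case (Cons a cs)
  then obtain p \<rho> where p: "p \<le> length cs" and \<rho>: "\<rho> permutes {1..length cs}"
    and \<pi>: "\<pi> = move_first p \<circ> block_perm 1 id \<rho>"
    using permutes_move_first_decomp[of \<pi> "length cs"] by auto
  define w where "w = permute_word \<rho> cs"
  have w: "set w \<subseteq> {..<d}" "length w = length cs"
    using Cons.prems(1) set_permute_word[OF \<rho>] by (simp_all add: w_def)
  have a: "a < d" and cs: "set cs \<subseteq> {..<d}" using Cons.prems(1) by simp_all
  have bp: "block_perm 1 id \<rho> permutes {1..Suc (length cs)}"
    using block_perm_permutes[OF permutes_id[of "{1..1}"] \<rho>] by simp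
  have mf: "move_first p permutes {1..Suc (length cs)}" using p by (intro move_first_permutes) simp
  define pre post where "pre = take p w" and "post = drop p w"
  have w_split: "w = pre @ post" "length pre = p"
    using p w(2) by (simp_all add: pre_def post_def)
  have "perm_act A (1 + length cs) (block_perm 1 id \<rho>) (s a \<otimes>\<^bsub>A\<^esub> monomial cs)
      = perm_act A 1 id (s a) \<otimes>\<^bsub>A\<^esub> perm_act A (length cs) \<rho> (monomial cs)"
    using s_grade[OF a] monomial_grade[OF cs] \<rho>
    by (intro mult_equivariant) (simp_all add: sym_group_carrier permutes_id)
  also have "\<dots> = monomial (a # w)"
    using Cons.IH[OF cs \<rho>] perm_id[OF s_grade[OF a]] by (simp add: w_def)
  finally have "perm_act A (length (a # cs)) \<pi> (monomial (a # cs))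
      = perm_act A (length (a # pre @ post)) (move_first p) (monomial (a # pre @ post))"
    unfolding \<pi> using perm_comp[OF mf bp] mult_grade[OF s_grade[OF a] monomial_grade[OF cs]] w w_split
    by simp
  also have "\<dots> = monomial (pre @ a # post)"
    using perm_move_first_monomial[OF a, of pre post] w w_split by simp
  also have "pre @ a # post = permute_word \<pi> (a # cs)"
    using permute_word_comp[of "move_first p" "a # cs" "block_perm 1 id \<rho>"] mf bp
      permute_word_block_perm[of id "[a]" \<rho> cs] \<rho> permute_word_move_first[of pre a post] w_split
    unfolding \<pi> by (simp add: permutes_id w_def)
  finally show ?case .
qed

lemma monomial_carrier: "monomial ` lists {..<d} \<subseteq> carrier A"
  using grade_carrier monomial_grade by auto

text \<open>The direct sum of the spans of the monomials of each length is a sub-tca that contains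
  the generators: products concatenate words, and the symmetric groups permute their
  letters.\<close>

lemma carrier_lspan_monomials: "carrier A \<subseteq> lspan R A (monomial ` lists {..<d})"
proof -
  define X where "X n = monomial ` {cs. set cs \<subseteq> {..<d} \<and> length cs = n}" for n
  define P where "P n = lspan R A (X n)" for n
  have X_grade: "X n \<subseteq> grade A n" for n using monomial_grade by (auto simp: X_def)
  then have X_carrier: "X n \<subseteq> carrier A" for n using grade_carrier by blast
  have P: "submodule (P n) R A" for n
    unfolding P_def by (rule lspan_submodule[OF X_carrier])
  have P_grade: "P n \<subseteq> grade A n" for n
    unfolding P_def by (rule lspan_least[OF grade_submodule X_grade])
  have X_sub: "X n \<subseteq> monomial ` lists {..<d}" for n by (auto simp: X_def)
  have total_lspan: "total P \<subseteq> lspan R A (monomial ` lists {..<d})"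
    using lspan_submodule[OF monomial_carrier] lspan_mono[OF X_sub]
    unfolding P_def by (intro total_least) auto
  have mono_total: "monomial cs \<in> total P" if "set cs \<subseteq> {..<d}" for cs
    using total_superset[of P "length cs", OF P P_grade] lspan_base[of "monomial cs" "X (length cs)"] that
    by (auto simp: P_def X_def)
  note sub = total_submodule[of P, OF P P_grade]
  have "sub_tca R A (total P)"
    unfolding sub_tca_def
  proof (intro conjI)
    show "submodule (total P) R A" by (rule sub)
    show "subring (total P) A"
    proof (rule ring.subringI[OF ring_A])
      show "total P \<subseteq> carrier A" using submoduleE(1)[OF sub] .
      show "\<one>\<^bsub>A\<^esub> \<in> total P" using mono_total[of "[]"] by simp
      show "\<ominus>\<^bsub>A\<^esub> x \<in> total P" if "x \<in> total P" for x using submoduleE(3)[OF sub that] .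
      show "x \<oplus>\<^bsub>A\<^esub> y \<in> total P" if "x \<in> total P" "y \<in> total P" for x y
        using submoduleE(5)[OF sub that] .
      show "x \<otimes>\<^bsub>A\<^esub> y \<in> total P" if xy: "x \<in> total P" "y \<in> total P" for x y
      proof (rule bilinear_lspan[OF module_A module_A sub, where \<beta> = "mult A"])
        show "x \<in> lspan R A (monomial ` lists {..<d})" "y \<in> lspan R A (monomial ` lists {..<d})"
          using xy total_lspan by blast+
        fix u v assume "u \<in> monomial ` lists {..<d}" "v \<in> monomial ` lists {..<d}"
        then obtain cs cs' where "set cs \<subseteq> {..<d}" "set cs' \<subseteq> {..<d}"
          "u = monomial cs" "v = monomial cs'" by auto
        then show "u \<otimes>\<^bsub>A\<^esub> v \<in> total P"
          using monomial_append[of cs cs'] mono_total[of "cs @ cs'"] by simp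
      qed (use monomial_carrier ring.ring_simprules[OF ring_A] mult_smult_left mult_smult_right in auto)
    qed
    show "graded_stable A (total P)"
    proof (rule total_graded_stable[of P, OF P P_grade])
      fix n \<sigma> x assume \<sigma>: "\<sigma> permutes {1..n}" and x: "x \<in> P n"
      show "perm_act A n \<sigma> x \<in> P n"
      proof (rule linear_image_lspan[OF module_A module_A grade_submodule P X_grade,
          where \<phi> = "perm_act A n \<sigma>"])
        show "x \<in> lspan R A (X n)" using x by (simp add: P_def)
        fix u assume "u \<in> X n"
        then obtain cs where cs: "set cs \<subseteq> {..<d}" "length cs = n" "u = monomial cs"
          by (auto simp: X_def)
        then have "perm_act A n \<sigma> u \<in> X n"
          using perm_monomial[OF cs(1)] set_permute_word[of \<sigma> cs] \<sigma> by (auto simp: X_def)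
        then show "perm_act A n \<sigma> u \<in> P n" unfolding P_def by (rule lspan_base)
      qed (use perm_add'[OF \<sigma>] perm_smult'[OF \<sigma>] grade_carrier[OF perm_closed[OF \<sigma>]] in auto)
    qed
  qed
  moreover have "s ` {..<d} \<subseteq> total P"
  proof
    fix x assume "x \<in> s ` {..<d}"
    then obtain c where c: "c < d" "x = s c" by auto
    then have "x = monomial [c]"
      using mult_one_right grade_carrier[OF s_grade] by simp
    then show "x \<in> total P" using mono_total[of "[c]"] c by simp
  qed
  ultimately have "carrier A \<subseteq> total P" using A_gen unfolding tca_generated_def by blast
  then show ?thesis using total_lspan by blast
qed

end

section \<open>Modules spanned by words\<close>

text \<open>Both families of generators are enumerated by natural numbers, so that words become
  lists over a linear order. The degree of \<open>t j\<close> is recorded as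
  \<open>e j\<close>.\<close>

locale generated_tca_module = tca_module R A M + degree_one_tca R A s d
  for R :: "('k, 'r) ring_scheme"
    and A :: "('k, 'a) sym_module"
    and M :: "('k, 'a, 'm) act_module"
    and s :: "nat \<Rightarrow> 'a" and d :: nat +
  fixes t :: "nat \<Rightarrow> 'm" and e :: "nat \<Rightarrow> nat" and r :: nat
  assumes noetherian: "noetherian_ring R"
    and t_grade: "j < r \<Longrightarrow> t j \<in> grade M (e j)"
    and M_gen: "submodule_generated R A M (t ` {..<r}) = carrier M"
begin

lemma module_M: "module R M"
  using M.graded_sym_module_axioms by (simp add: graded_sym_module_def)

text \<open>
  Letters below \<open>d\<close> stand for the generators of \<open>A\<close>.  A word for \<open>\<sigma> \<cdot> (s c\<^sub>1 \<dots> s c\<^sub>k t j)\<close> consists of a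
  header letter \<open>d + j\<close>, followed by the letters \<open>c\<^sub>1, \<dots>, c\<^sub>k\<close> and \<open>e j\<close> distinct marks, permuted
  by \<open>\<sigma>\<close>.  The header is needed because \<open>e j\<close> may be \<open>0\<close>; it contributes \<open>1\<close> to the length.
\<close>

definition marks :: "nat \<Rightarrow> nat list" where
  "marks j = map (\<lambda>i. d + r + i) [0..<e j]"

definition word_data :: "nat \<Rightarrow> (nat \<Rightarrow> nat) \<Rightarrow> nat list \<Rightarrow> bool" where
  "word_data j \<sigma> cs \<longleftrightarrow> j < r \<and> set cs \<subseteq> {..<d} \<and> \<sigma> permutes {1..length cs + e j}"

definition word :: "nat \<Rightarrow> (nat \<Rightarrow> nat) \<Rightarrow> nat list \<Rightarrow> nat list" where
  "word j \<sigma> cs = (d + j) # permute_word \<sigma> (cs @ marks j)"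

definition word_elem :: "nat \<Rightarrow> (nat \<Rightarrow> nat) \<Rightarrow> nat list \<Rightarrow> 'm" where
  "word_elem j \<sigma> cs = perm_act M (length cs + e j) \<sigma> (lact M (monomial cs) (t j))"

definition words :: "nat list set" where
  "words = {word j \<sigma> cs | j \<sigma> cs. word_data j \<sigma> cs}"

text \<open>The choice among presentations of a word does not matter by \<open>word_elem_eq\<close>;
  \<open>val_word\<close> is the usable form of the definition.\<close>

definition val :: "nat list \<Rightarrow> 'm" where
  "val w = (SOME y. \<exists>j \<sigma> cs. word_data j \<sigma> cs \<and> w = word j \<sigma> cs \<and> y = word_elem j \<sigma> cs)"

lemma length_marks [simp]: "length (marks j) = e j"
  by (simp add: marks_def)

lemma length_word [simp]: "length (word j \<sigma> cs) = Suc (length cs + e j)"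
  by (simp add: word_def)

lemma lact_monomial_grade:
  assumes "set cs \<subseteq> {..<d}" "j < r"
  shows "lact M (monomial cs) (t j) \<in> grade M (length cs + e j)"
  using lact_grade[OF monomial_grade[OF assms(1)] t_grade[OF assms(2)]] .

text \<open>Two presentations of the same word differ by a permutation of the letters \<open>c\<^sub>1, \<dots>, c\<^sub>k\<close> alone, since the
  marks are distinct; twisted commutativity absorbs it.\<close>

lemma word_elem_eq:
  assumes v: "word_data j \<sigma> cs" "word_data j' \<sigma>' cs'" and eq: "word j \<sigma> cs = word j' \<sigma>' cs'"
  shows "word_elem j \<sigma> cs = word_elem j' \<sigma>' cs'"
proof -
  have j: "j' = j" using eq by (simp add: word_def)
  have len: "length cs' = length cs" using arg_cong[OF eq, of length] j by simp
  define n where "n = length cs + e j"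
  have \<sigma>: "\<sigma> permutes {1..n}" and \<sigma>': "\<sigma>' permutes {1..n}"
    using v j len by (simp_all add: word_data_def n_def)
  have cs: "set cs \<subseteq> {..<d}" "set cs' \<subseteq> {..<d}" "j < r" using v by (simp_all add: word_data_def)
  \<comment> \<open>The relative permutation of the two presentations: it carries
    \<open>cs' @ marks j\<close> to \<open>cs @ marks j\<close>, and therefore fixes the places of
    the marks.\<close>
  define \<pi> where "\<pi> = inv' \<sigma> \<circ> \<sigma>'"
  have inv: "inv' \<sigma> permutes {1..n}" by (rule permutes_inv[OF \<sigma>])
  have \<pi>: "\<pi> permutes {1..n}" unfolding \<pi>_def by (rule permutes_compose[OF \<sigma>' inv])
  have len': "length (cs' @ marks j) = n" "length (cs @ marks j) = n" by (simp_all add: n_def len)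
  have "permute_word \<pi> (cs' @ marks j) = permute_word (inv' \<sigma>) (permute_word \<sigma>' (cs' @ marks j))"
    unfolding \<pi>_def using inv \<sigma>' by (intro permute_word_comp) (simp_all only: len')
  also have "permute_word \<sigma>' (cs' @ marks j) = permute_word \<sigma> (cs @ marks j)"
    using eq j by (simp add: word_def)
  also have "permute_word (inv' \<sigma>) (permute_word \<sigma> (cs @ marks j)) = permute_word (inv' \<sigma> \<circ> \<sigma>) (cs @ marks j)"
    using inv \<sigma> by (intro permute_word_comp[symmetric]) (simp_all only: len')
  also have "\<dots> = cs @ marks j" using permutes_inv_o(2)[OF \<sigma>] by simp
  finally have perm: "permute_word \<pi> (cs' @ marks j) = cs @ marks j" .
  have dis: "distinct (marks j)" "set cs \<inter> set (marks j) = {}"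
    using cs(1) by (auto simp: marks_def distinct_map inj_on_def)
  have \<pi>': "\<pi> permutes {1..length (cs' @ marks j)}" using \<pi> len' by simp
  note fixed = permute_word_append_fix[OF \<pi>' perm dis]
  have mono: "monomial cs' \<in> grade A (length cs)" using monomial_grade[OF cs(2)] len by simp
  have "perm_act M n \<pi> (lact M (monomial cs') (t j))
      = perm_act M (length cs + e j) (block_perm (length cs) \<pi> id) (lact M (monomial cs') (t j))"
    using permutes_eq_block_perm[OF fixed(1)] len by (simp add: n_def)
  also have "\<dots> = lact M (perm_act A (length cs) \<pi> (monomial cs')) (perm_act M (e j) id (t j))"
    using fixed(1) mono t_grade[OF cs(3)] len
    by (intro lact_equivariant) (simp_all add: sym_group_carrier permutes_id)
  also have "\<dots> = lact M (monomial cs) (t j)"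
    using perm_monomial[OF cs(2) fixed(1)] fixed(2) M.perm_id[OF t_grade[OF cs(3)]] len by simp
  finally have *: "perm_act M n \<pi> (lact M (monomial cs') (t j)) = lact M (monomial cs) (t j)" .
  have "\<sigma> \<circ> \<pi> = \<sigma>'"
    unfolding \<pi>_def using permutes_inverses(1)[OF \<sigma>] by (auto simp: fun_eq_iff)
  moreover have "lact M (monomial cs') (t j) \<in> grade M n"
    using lact_monomial_grade[OF cs(2,3)] len by (simp add: n_def)
  ultimately have "perm_act M n \<sigma>' (lact M (monomial cs') (t j))
      = perm_act M n \<sigma> (perm_act M n \<pi> (lact M (monomial cs') (t j)))"
    using M.perm_comp[OF \<sigma> \<pi>] by metis
  then show ?thesis using * j len by (simp add: word_elem_def n_def)
qed

lemma val_word: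
  assumes "word_data j \<sigma> cs"
  shows "val (word j \<sigma> cs) = word_elem j \<sigma> cs"
proof -
  have "\<exists>j' \<sigma>' cs'. word_data j' \<sigma>' cs' \<and> word j \<sigma> cs = word j' \<sigma>' cs'
      \<and> val (word j \<sigma> cs) = word_elem j' \<sigma>' cs'"
    unfolding val_def by (rule someI) (use assms in blast)
  then show ?thesis using word_elem_eq[OF assms] by metis
qed

lemma wordsE:
  assumes "w \<in> words"
  obtains j \<sigma> cs where "word_data j \<sigma> cs" "w = word j \<sigma> cs" "val w = word_elem j \<sigma> cs"
  using assms val_word unfolding words_def by auto

lemma word_elem_grade: "word_data j \<sigma> cs \<Longrightarrow> word_elem j \<sigma> cs \<in> grade M (length cs + e j)"
  unfolding word_elem_def word_data_def using M.perm_closed lact_monomial_grade by blast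

lemma val_grade: "w \<in> words \<Longrightarrow> val w \<in> grade M (length w - 1)"
  by (elim wordsE) (simp add: word_elem_grade)

lemma val_carrier: "w \<in> words \<Longrightarrow> val w \<in> carrier M"
  using val_grade M.grade_carrier by blast

lemma words_finite_alphabet: "words \<subseteq> lists {..<d + r + (\<Sum>j<r. e j)}"
proof
  fix w assume "w \<in> words"
  then obtain j \<sigma> cs where w: "word_data j \<sigma> cs" "w = word j \<sigma> cs" by (elim wordsE)
  then have j: "j < r" by (simp add: word_data_def)
  have "set (permute_word \<sigma> (cs @ marks j)) = set (cs @ marks j)"
    using w by (intro set_permute_word) (simp add: word_data_def)
  \<comment> \<open>The marks of \<open>t j\<close> are \<open>d + r + i\<close> with
    \<open>i < e j\<close>; the sum serves as one bound for all \<open>j\<close>.\<close>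
  moreover have "e j \<le> (\<Sum>j<r. e j)" using j by (intro member_le_sum) auto
  ultimately show "w \<in> lists {..<d + r + (\<Sum>j<r. e j)}"
    using w j by (force simp: word_def word_data_def marks_def)
qed

lemma finite_words_length: "finite {w \<in> words. length w = n}"
  using words_finite_alphabet
  by (intro finite_subset[OF _ finite_lists_length_eq[of "{..<d + r + (\<Sum>j<r. e j)}" n]]) auto

text \<open>The header of \<open>u\<close> occurs in \<open>w\<close>, and the tail of
  \<open>w\<close> has no letters from \<open>d\<close> to \<open>d + r - 1\<close>, so the headers
  agree. Both tails then contain equally many marks, and only letters below \<open>d\<close> can
  have been inserted.\<close>

lemma words_subseq:
  assumes "u \<in> words" "w \<in> words" "subseq u w"
  obtains h u' w' where "u = h # u'" "w = h # w'" "(single_insert {..<d})\<^sup>*\<^sup>* u' w'"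
proof -
  have tail: "length (filter (\<lambda>c. c \<notin> {..<d}) (permute_word \<sigma> (cs @ marks j))) = e j"
    "set (permute_word \<sigma> (cs @ marks j)) \<subseteq> {..<d} \<union> {d + r..}" if "word_data j \<sigma> cs" for j \<sigma> cs
  proof -
    have \<sigma>: "\<sigma> permutes {1..length (cs @ marks j)}" using that by (simp add: word_data_def)
    have "mset (permute_word \<sigma> (cs @ marks j)) = mset (cs @ marks j)"
      by (rule mset_permute_word[OF \<sigma>])
    then have "size (filter_mset (\<lambda>c. c \<notin> {..<d}) (mset (permute_word \<sigma> (cs @ marks j))))
        = size (filter_mset (\<lambda>c. c \<notin> {..<d}) (mset (cs @ marks j)))" by simp
    also have "\<dots> = length (filter (\<lambda>c. c \<notin> {..<d}) (cs @ marks j))"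
      by (simp only: mset_filter[symmetric] size_mset)
    also have "filter (\<lambda>c. c \<notin> {..<d}) cs = []" "filter (\<lambda>c. c \<notin> {..<d}) (marks j) = marks j"
      using that by (auto simp: word_data_def marks_def filter_empty_conv filter_id_conv)
    then have "length (filter (\<lambda>c. c \<notin> {..<d}) (cs @ marks j)) = e j"
      by (simp only: filter_append) simp
    finally show "length (filter (\<lambda>c. c \<notin> {..<d}) (permute_word \<sigma> (cs @ marks j))) = e j"
      by (simp only: mset_filter[symmetric] size_mset)
    show "set (permute_word \<sigma> (cs @ marks j)) \<subseteq> {..<d} \<union> {d + r..}"
      using set_permute_word[OF \<sigma>] that by (auto simp: word_data_def marks_def)
  qed
  from assms(1) obtain j \<sigma> cs where u: "word_data j \<sigma> cs" "u = word j \<sigma> cs" by (elim wordsE)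
  from assms(2) obtain j' \<sigma>' cs' where w: "word_data j' \<sigma>' cs'" "w = word j' \<sigma>' cs'" by (elim wordsE)
  have "d + j \<in> set w"
    using assms(3) u by (auto simp: word_def dest: list_emb_set)
  then have j: "j' = j"
    using tail(2)[OF w(1)] w u by (auto simp: word_def word_data_def)
  have "(single_insert {..<d})\<^sup>*\<^sup>* (permute_word \<sigma> (cs @ marks j)) (permute_word \<sigma>' (cs' @ marks j))"
    using assms(3) u w j tail(1)[OF u(1)] tail(1)[OF w(1)]
    by (intro subseq_imp_single_inserts) (simp_all add: word_def)
  then show ?thesis using that u w j by (simp add: word_def)
qed

text \<open>Here \<open>n\<close> is the degree of the argument. Multiplication puts the new letter
  in front, and \<open>move_first\<close> carries it past \<open>p\<close> letters.\<close>

definition insert_letter :: "nat \<Rightarrow> nat \<Rightarrow> nat \<Rightarrow> 'm \<Rightarrow> 'm" where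
  "insert_letter n p c y = perm_act M (Suc n) (move_first p) (lact M (s c) y)"

lemma insert_letter_word:
  assumes "h # xs @ ys \<in> words" "c < d"
  shows "h # xs @ c # ys \<in> words"
    and "val (h # xs @ c # ys) = insert_letter (length (xs @ ys)) (length xs) c (val (h # xs @ ys))"
proof -
  from assms(1) obtain j \<sigma> cs where w: "word_data j \<sigma> cs" "h # xs @ ys = word j \<sigma> cs"
      "val (h # xs @ ys) = word_elem j \<sigma> cs" by (elim wordsE)
  define n where "n = length cs + e j"
  have n: "length (xs @ ys) = n" using arg_cong[OF w(2), of length] by (simp add: n_def)
  have \<sigma>: "\<sigma> permutes {1..n}" and cs: "set cs \<subseteq> {..<d}" and j: "j < r"
    using w(1) by (simp_all add: word_data_def n_def)
  have bp: "block_perm 1 id \<sigma> permutes {1..Suc n}"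
    using block_perm_permutes[OF permutes_id[of "{1..1}"] \<sigma>] by simp
  have mf: "move_first (length xs) permutes {1..Suc n}"
    using n by (intro move_first_permutes) simp
  \<comment> \<open>The new letter stays in front while \<open>\<sigma>\<close> arranges the other
    places, and is then moved behind \<open>xs\<close>.\<close>
  define \<sigma>' where "\<sigma>' = move_first (length xs) \<circ> block_perm 1 id \<sigma>"
  have data: "word_data j \<sigma>' (c # cs)"
    using permutes_compose[OF bp mf] cs j assms(2) by (simp add: word_data_def \<sigma>'_def n_def)
  have "permute_word \<sigma>' ((c # cs) @ marks j)
      = permute_word (move_first (length xs)) (permute_word (block_perm 1 id \<sigma>) ([c] @ (cs @ marks j)))"
    unfolding \<sigma>'_def using permute_word_comp[OF _ _ , of "move_first (length xs)" "(c # cs) @ marks j" "block_perm 1 id \<sigma>"]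
      mf bp by (simp add: n_def)
  also have "permute_word (block_perm 1 id \<sigma>) ([c] @ (cs @ marks j)) = c # permute_word \<sigma> (cs @ marks j)"
    using permute_word_block_perm[of id "[c]" \<sigma> "cs @ marks j"] \<sigma> by (simp add: permutes_id n_def)
  also have "permute_word \<sigma> (cs @ marks j) = xs @ ys" using w(2) by (simp add: word_def)
  also have "permute_word (move_first (length xs)) (c # xs @ ys) = xs @ c # ys"
    by (rule permute_word_move_first)
  finally have word: "h # xs @ c # ys = word j \<sigma>' (c # cs)"
    using w(2) by (simp add: word_def)
  then show "h # xs @ c # ys \<in> words" using data by (auto simp: words_def)
  define m where "m = lact M (monomial cs) (t j)"
  have m: "m \<in> grade M n" using lact_monomial_grade[OF cs j] by (simp add: m_def n_def)
  have sc: "s c \<in> grade A 1" by (rule s_grade[OF assms(2)])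
  have lact_m: "lact M (monomial (c # cs)) (t j) = lact M (s c) m"
    using lact_mult[OF A.grade_carrier[OF sc] A.grade_carrier[OF monomial_grade[OF cs]]
        M.grade_carrier[OF t_grade[OF j]]] by (simp add: m_def)
  have gr: "lact M (s c) m \<in> grade M (Suc n)" using lact_grade[OF sc m] by simp
  have "val (h # xs @ c # ys) = perm_act M (Suc n) \<sigma>' (lact M (s c) m)"
    using word val_word[OF data] lact_m by (simp add: word_elem_def n_def)
  also have "\<dots> = perm_act M (Suc n) (move_first (length xs))
      (perm_act M (Suc n) (block_perm 1 id \<sigma>) (lact M (s c) m))"
    unfolding \<sigma>'_def by (rule M.perm_comp[OF mf bp gr])
  also have "perm_act M (1 + n) (block_perm 1 id \<sigma>) (lact M (s c) m)
      = lact M (perm_act A 1 id (s c)) (perm_act M n \<sigma> m)"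
    using \<sigma> sc m by (intro lact_equivariant) (simp_all add: sym_group_carrier permutes_id)
  then have "perm_act M (Suc n) (block_perm 1 id \<sigma>) (lact M (s c) m) = lact M (s c) (val (h # xs @ ys))"
    using A.perm_id[OF sc] w(3) by (simp add: word_elem_def n_def m_def)
  finally show "val (h # xs @ c # ys)
      = insert_letter (length (xs @ ys)) (length xs) c (val (h # xs @ ys))"
    using n by (simp add: insert_letter_def)
qed

lemma cring_R: "cring R" and ring_R: "ring R"
  using module_M by (simp_all add: module_def cring_def)

section \<open>The values of words span the module in each degree\<close>

definition words_of_degree :: "nat \<Rightarrow> nat list set" where
  "words_of_degree n = {w \<in> words. length w = Suc n}"

lemma words_of_degree_word:
  "word_data j \<sigma> cs \<Longrightarrow> word j \<sigma> cs \<in> words_of_degree (length cs + e j)"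
  by (auto simp: words_of_degree_def words_def)

lemma perm_val:
  assumes "w \<in> words_of_degree n" "\<rho> permutes {1..n}"
  shows "perm_act M n \<rho> (val w) \<in> val ` words_of_degree n"
proof -
  from assms(1) obtain j \<sigma> cs where w: "word_data j \<sigma> cs" "w = word j \<sigma> cs" "val w = word_elem j \<sigma> cs"
    unfolding words_of_degree_def by (auto elim: wordsE)
  have n: "n = length cs + e j" using assms(1) w(2) by (simp add: words_of_degree_def)
  have data: "word_data j (\<rho> \<circ> \<sigma>) cs"
    using w(1) permutes_compose[OF _ assms(2)] n by (simp add: word_data_def)
  have "perm_act M n \<rho> (val w) = word_elem j (\<rho> \<circ> \<sigma>) cs"
    using w assms(2) n M.perm_comp[of \<rho> n \<sigma>] lact_monomial_grade[of cs j]
    by (simp add: word_elem_def word_data_def)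
  then show ?thesis
    using val_word[OF data] words_of_degree_word[OF data] n by (metis image_eqI)
qed

text \<open>The letters \<open>bs\<close> are put in front and \<open>\<sigma>\<close> is shifted
  past them, which is what equivariance under \<open>block_perm\<close> provides.\<close>

lemma lact_monomial_val:
  assumes "w \<in> words" "set bs \<subseteq> {..<d}"
  shows "lact M (monomial bs) (val w) \<in> val ` words"
proof -
  from assms(1) obtain j \<sigma> cs where w: "word_data j \<sigma> cs" "val w = word_elem j \<sigma> cs"
    by (elim wordsE)
  define n where "n = length cs + e j"
  have \<sigma>: "\<sigma> permutes {1..n}" and cs: "set cs \<subseteq> {..<d}" and j: "j < r"
    using w(1) by (simp_all add: word_data_def n_def)
  define \<sigma>' where "\<sigma>' = block_perm (length bs) id \<sigma>"
  have data: "word_data j \<sigma>' (bs @ cs)"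
    using block_perm_permutes[OF permutes_id[of "{1..length bs}"] \<sigma>] cs j assms(2)
    by (simp add: word_data_def \<sigma>'_def n_def add.assoc)
  define m where "m = lact M (monomial cs) (t j)"
  have m: "m \<in> grade M n" using lact_monomial_grade[OF cs j] by (simp add: m_def n_def)
  have mb: "monomial bs \<in> grade A (length bs)" by (rule monomial_grade[OF assms(2)])
  have "lact M (monomial (bs @ cs)) (t j) = lact M (monomial bs) m"
    unfolding monomial_append[OF assms(2) cs] m_def
    by (rule lact_mult[OF A.grade_carrier[OF mb] A.grade_carrier[OF monomial_grade[OF cs]]
        M.grade_carrier[OF t_grade[OF j]]])
  then have "word_elem j \<sigma>' (bs @ cs) = perm_act M (length bs + n) \<sigma>' (lact M (monomial bs) m)"
    by (simp add: word_elem_def n_def add.assoc)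
  also have "\<dots> = lact M (perm_act A (length bs) id (monomial bs)) (perm_act M n \<sigma> m)"
    unfolding \<sigma>'_def using \<sigma> mb m
    by (intro lact_equivariant) (simp_all add: sym_group_carrier permutes_id)
  also have "\<dots> = lact M (monomial bs) (val w)"
    using A.perm_id[OF mb] w(2) by (simp add: word_elem_def m_def n_def)
  finally have "lact M (monomial bs) (val w) = val (word j \<sigma>' (bs @ cs))"
    using val_word[OF data] by simp
  then show ?thesis using data by (auto simp: words_def)
qed

lemma t_in_val_words:
  assumes "j < r" shows "t j \<in> val ` words"
proof -
  have data: "word_data j id []" using assms by (simp add: word_data_def permutes_id)
  have "word_elem j id [] = t j"
    using M.perm_id[OF t_grade[OF assms]] lact_one[OF M.grade_carrier[OF t_grade[OF assms]]]
    by (simp add: word_elem_def)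
  then have "t j = val (word j id [])" using val_word[OF data] by simp
  then show ?thesis using data by (auto simp: words_def)
qed

lemma val_words_of_degree: "val ` words_of_degree n \<subseteq> grade M n"
  using val_grade by (fastforce simp: words_of_degree_def)

lemma val_words_carrier: "val ` words \<subseteq> carrier M"
  using val_carrier by blast

text \<open>The direct sum of these spans is stable under the symmetric groups and under monomials,
  hence under \<open>A\<close>, and it contains the generators \<open>t j\<close>. It is thus all of
  \<open>M\<close>, and \<open>total_grade\<close> returns to degree \<open>n\<close>.\<close>

lemma grade_lspan_words: "grade M n \<subseteq> lspan R M (val ` words_of_degree n)"
proof -
  define P where "P n = lspan R M (val ` words_of_degree n)" for n
  have deg_carrier: "val ` words_of_degree n \<subseteq> carrier M" for n
    using val_words_carrier by (auto simp: words_of_degree_def)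
  have P: "submodule (P n) R M" for n
    unfolding P_def by (rule M.lspan_submodule[OF deg_carrier])
  have P_grade: "P n \<subseteq> grade M n" for n
    unfolding P_def by (rule M.lspan_least[OF M.grade_submodule val_words_of_degree])
  note sub = M.total_submodule[of P, OF P P_grade]
  have total_lspan: "M.total P \<subseteq> lspan R M (val ` words)"
    using M.lspan_submodule[OF val_words_carrier]
    unfolding P_def
    by (intro M.total_least M.lspan_mono) (auto simp: words_of_degree_def)
  have val_total: "val ` words \<subseteq> M.total P"
  proof
    fix y assume "y \<in> val ` words"
    then obtain w where w: "w \<in> words" "y = val w" by blast
    then obtain j \<sigma> cs where "word_data j \<sigma> cs" "w = word j \<sigma> cs" by (elim wordsE)
    then have "y \<in> P (length cs + e j)"
      unfolding P_def using w(2) words_of_degree_word by (intro M.lspan_base) auto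
    then show "y \<in> M.total P"
      using M.total_superset[of P, OF P P_grade] by blast
  qed
  have "tca_submodule R A M (M.total P)"
    unfolding tca_submodule_def
  proof (intro conjI ballI)
    show "submodule (M.total P) R M" by (rule sub)
    show "lact M a x \<in> M.total P" if "a \<in> carrier A" "x \<in> M.total P" for a x
    proof (rule bilinear_lspan[OF module_A module_M sub, where \<beta> = "lact M"])
      show "a \<in> lspan R A (monomial ` lists {..<d})"
        using carrier_lspan_monomials that(1) by blast
      show "x \<in> lspan R M (val ` words)" using total_lspan that(2) by blast
      fix u v assume "u \<in> monomial ` lists {..<d}" "v \<in> val ` words"
      then show "lact M u v \<in> M.total P"
        using lact_monomial_val val_total by fastforce
    qed (use monomial_carrier val_words_carrier lact_closed lact_add_left lact_add_right
        lact_smult_left lact_smult_right in auto)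
    show "graded_stable M (M.total P)"
    proof (rule M.total_graded_stable[of P, OF P P_grade])
      fix n \<sigma> x assume \<sigma>: "\<sigma> permutes {1..n}" and x: "x \<in> P n"
      show "perm_act M n \<sigma> x \<in> P n"
      proof (rule linear_image_lspan[OF module_M module_M M.grade_submodule P val_words_of_degree,
            where \<phi> = "perm_act M n \<sigma>"])
        show "x \<in> lspan R M (val ` words_of_degree n)" using x by (simp add: P_def)
        fix u assume "u \<in> val ` words_of_degree n"
        then have "perm_act M n \<sigma> u \<in> val ` words_of_degree n"
          using perm_val[OF _ \<sigma>] by blast
        then show "perm_act M n \<sigma> u \<in> P n" unfolding P_def by (rule M.lspan_base)
      qed (use M.perm_add'[OF \<sigma>] M.perm_smult'[OF \<sigma>] M.grade_carrier[OF M.perm_closed[OF \<sigma>]] in auto)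
    qed
  qed
  moreover have "t ` {..<r} \<subseteq> M.total P" using t_in_val_words val_total by blast
  ultimately have "carrier M \<subseteq> M.total P"
    using M_gen unfolding submodule_generated_def by blast
  then show ?thesis
    using M.total_grade[of P, OF P P_grade] M.grade_carrier unfolding P_def by blast
qed

section \<open>Leading coefficients\<close>

text \<open>The header takes part in the comparison, so smaller words may belong to other
  generators; equal length keeps their values in one degree.\<close>

definition smaller_words :: "nat list \<Rightarrow> nat list set" where
  "smaller_words w = {u \<in> words. length u = length w \<and> u < w}"

text \<open>The values of words may satisfy linear relations, so leading coefficients are attached to formal
  expressions rather than to elements of \<open>N\<close>.\<close>

definition leading_coeffs :: "'m set \<Rightarrow> nat list \<Rightarrow> 'k set" where
  "leading_coeffs N w = {a \<in> carrier R.
     \<exists>l\<in>lspan R M (val ` smaller_words w). a \<odot>\<^bsub>M\<^esub> val w \<oplus>\<^bsub>M\<^esub> l \<in> N}"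

lemma smaller_words_carrier: "val ` smaller_words w \<subseteq> carrier M"
  using val_carrier by (auto simp: smaller_words_def)

lemma lspan_smaller_carrier: "l \<in> lspan R M (val ` smaller_words w) \<Longrightarrow> l \<in> carrier M"
  using M.lspan_least[OF M.carrier_is_submodule smaller_words_carrier] by blast

lemma leading_coeffs_ideal:
  assumes N: "submodule N R M" and w: "w \<in> words"
  shows "ideal (leading_coeffs N w) R"
proof -
  define L where "L = lspan R M (val ` smaller_words w)"
  have L: "submodule L R M" unfolding L_def by (rule M.lspan_submodule[OF smaller_words_carrier])
  have L_carrier: "l \<in> carrier M" if "l \<in> L" for l using that lspan_smaller_carrier by (simp add: L_def)
  have v: "val w \<in> carrier M" by (rule val_carrier[OF w])
  have I: "leading_coeffs N w = {a \<in> carrier R. \<exists>l\<in>L. a \<odot>\<^bsub>M\<^esub> val w \<oplus>\<^bsub>M\<^esub> l \<in> N}"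
    by (simp add: leading_coeffs_def L_def)
  have smult: "b \<otimes>\<^bsub>R\<^esub> a \<in> leading_coeffs N w" if "a \<in> leading_coeffs N w" "b \<in> carrier R" for a b
  proof -
    from that(1) obtain l where a: "a \<in> carrier R" and l: "l \<in> L" "a \<odot>\<^bsub>M\<^esub> val w \<oplus>\<^bsub>M\<^esub> l \<in> N"
      unfolding I by blast
    have "b \<odot>\<^bsub>M\<^esub> (a \<odot>\<^bsub>M\<^esub> val w \<oplus>\<^bsub>M\<^esub> l) = (b \<otimes>\<^bsub>R\<^esub> a) \<odot>\<^bsub>M\<^esub> val w \<oplus>\<^bsub>M\<^esub> b \<odot>\<^bsub>M\<^esub> l"
      using a that(2) v L_carrier[OF l(1)] by (simp add: M.smult_r_distr M.smult_assoc1)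
    moreover have "b \<odot>\<^bsub>M\<^esub> (a \<odot>\<^bsub>M\<^esub> val w \<oplus>\<^bsub>M\<^esub> l) \<in> N" "b \<odot>\<^bsub>M\<^esub> l \<in> L"
      using M.submoduleE(4)[OF N that(2) l(2)] M.submoduleE(4)[OF L that(2) l(1)] .
    ultimately show ?thesis unfolding I using a that(2) by auto
  qed
  have add: "a \<oplus>\<^bsub>R\<^esub> b \<in> leading_coeffs N w"
    if "a \<in> leading_coeffs N w" "b \<in> leading_coeffs N w" for a b
  proof -
    from that(1) obtain l where a: "a \<in> carrier R" and l: "l \<in> L" "a \<odot>\<^bsub>M\<^esub> val w \<oplus>\<^bsub>M\<^esub> l \<in> N"
      unfolding I by blast
    from that(2) obtain m where b: "b \<in> carrier R" and m: "m \<in> L" "b \<odot>\<^bsub>M\<^esub> val w \<oplus>\<^bsub>M\<^esub> m \<in> N"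
      unfolding I by blast
    have "(a \<odot>\<^bsub>M\<^esub> val w \<oplus>\<^bsub>M\<^esub> l) \<oplus>\<^bsub>M\<^esub> (b \<odot>\<^bsub>M\<^esub> val w \<oplus>\<^bsub>M\<^esub> m)
        = (a \<oplus>\<^bsub>R\<^esub> b) \<odot>\<^bsub>M\<^esub> val w \<oplus>\<^bsub>M\<^esub> (l \<oplus>\<^bsub>M\<^esub> m)"
      using a b v L_carrier[OF l(1)] L_carrier[OF m(1)] by (simp add: M.smult_l_distr M.M.add.m_ac)
    moreover have "(a \<odot>\<^bsub>M\<^esub> val w \<oplus>\<^bsub>M\<^esub> l) \<oplus>\<^bsub>M\<^esub> (b \<odot>\<^bsub>M\<^esub> val w \<oplus>\<^bsub>M\<^esub> m) \<in> N" "l \<oplus>\<^bsub>M\<^esub> m \<in> L"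
      using M.submoduleE(5)[OF N l(2) m(2)] M.submoduleE(5)[OF L l(1) m(1)] .
    ultimately show ?thesis unfolding I using a b by auto
  qed
  have zero: "\<zero>\<^bsub>R\<^esub> \<in> leading_coeffs N w"
    unfolding I using M.submodule_zero[OF N] M.submodule_zero[OF L] v by force
  have sub: "leading_coeffs N w \<subseteq> carrier R" unfolding I by blast
  show ?thesis
    using sub zero add smult by (rule cring.ideal_by_closureI[OF cring_R])
qed

text \<open>Insertion at a fixed place is linear on the degree in question, maps \<open>N\<close>
  into itself and preserves the word order. It therefore sends an expression with leading word
  \<open>h # xs @ ys\<close> to one with leading word \<open>h # xs @ c # ys\<close> and the same
  coefficient.\<close>

lemma leading_coeffs_insert:
  assumes N: "tca_submodule R A M N" and w: "h # xs @ ys \<in> words" and c: "c < d"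
  shows "leading_coeffs N (h # xs @ ys) \<subseteq> leading_coeffs N (h # xs @ c # ys)"
proof
  define n where "n = length (xs @ ys)"
  define \<phi> where "\<phi> = insert_letter n (length xs) c"
  have mf: "move_first (length xs) permutes {1..Suc n}"
    by (intro move_first_permutes) (simp add: n_def)
  have sc: "s c \<in> grade A 1" by (rule s_grade[OF c])
  have sc': "s c \<in> carrier A" by (rule A.grade_carrier[OF sc])
  have lact_gr: "lact M (s c) y \<in> grade M (Suc n)" if "y \<in> grade M n" for y
    using lact_grade[OF sc that] by simp
  have \<phi>_grade: "\<phi> y \<in> grade M (Suc n)" if "y \<in> grade M n" for y
    unfolding \<phi>_def insert_letter_def by (rule M.perm_closed[OF mf lact_gr[OF that]])
  have \<phi>_add: "\<phi> (x \<oplus>\<^bsub>M\<^esub> y) = \<phi> x \<oplus>\<^bsub>M\<^esub> \<phi> y" if "x \<in> grade M n" "y \<in> grade M n" for x y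
    unfolding \<phi>_def insert_letter_def
    using lact_add_right[OF sc' M.grade_carrier[OF that(1)] M.grade_carrier[OF that(2)]]
      M.perm_add'[OF mf lact_gr[OF that(1)] lact_gr[OF that(2)]] by simp
  have \<phi>_smult: "\<phi> (a \<odot>\<^bsub>M\<^esub> y) = a \<odot>\<^bsub>M\<^esub> \<phi> y" if "a \<in> carrier R" "y \<in> grade M n" for a y
    unfolding \<phi>_def insert_letter_def
    using lact_smult_right[OF that(1) sc' M.grade_carrier[OF that(2)]]
      M.perm_smult'[OF mf that(1) lact_gr[OF that(2)]] by simp
  have \<phi>_N: "\<phi> y \<in> N" if "y \<in> N" "y \<in> grade M n" for y
  proof -
    have "lact M (s c) y \<in> N \<inter> grade M (Suc n)"
      using N that sc' lact_gr unfolding tca_submodule_def by blast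
    then show ?thesis
      using N mf unfolding tca_submodule_def graded_stable_def \<phi>_def insert_letter_def
      by (simp add: sym_group_carrier)
  qed
  have small_grade: "val ` smaller_words (h # xs @ ys) \<subseteq> grade M n"
    using val_grade by (fastforce simp: smaller_words_def n_def)
  have \<phi>_span: "\<phi> l \<in> lspan R M (val ` smaller_words (h # xs @ c # ys))"
    if "l \<in> lspan R M (val ` smaller_words (h # xs @ ys))" for l
  proof (rule linear_image_lspan[OF module_M module_M M.grade_submodule
        M.lspan_submodule[OF smaller_words_carrier] small_grade, where \<phi> = \<phi>])
    fix x assume "x \<in> val ` smaller_words (h # xs @ ys)"
    then obtain u where u: "u \<in> words" "length u = length (h # xs @ ys)" "u < h # xs @ ys" "x = val u"
      by (auto simp: smaller_words_def)
    \<comment> \<open>The smaller word may have another header and other letters; it is cut at the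
      same place, because \<open>\<phi>\<close> depends only on the place and on
      \<open>c\<close>.\<close>
    define xs' ys' where "xs' = take (length xs) (tl u)" and "ys' = drop (length xs) (tl u)"
    have split: "u = hd u # xs' @ ys'" "length xs' = length xs" "length ys' = length ys"
      using u(2) by (cases u; simp add: xs'_def ys'_def)+
    have "val (hd u # xs' @ c # ys') = \<phi> x" "hd u # xs' @ c # ys' \<in> words"
      using insert_letter_word[of "hd u" xs' ys' c] u(1,4) split c by (simp_all add: \<phi>_def n_def)
    moreover have "(hd u # xs') @ c # ys' < (h # xs) @ c # ys"
      using u(3) split by (intro insert_letter_less) simp_all
    ultimately have "\<phi> x \<in> val ` smaller_words (h # xs @ c # ys)"
      using split by (auto simp: smaller_words_def intro!: image_eqI[of _ _ "hd u # xs' @ c # ys'"])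
    then show "\<phi> x \<in> lspan R M (val ` smaller_words (h # xs @ c # ys))" by (rule M.lspan_base)
  qed (use \<phi>_add \<phi>_smult M.grade_carrier[OF \<phi>_grade] that in auto)
  fix a assume "a \<in> leading_coeffs N (h # xs @ ys)"
  then obtain l where a: "a \<in> carrier R" and l: "l \<in> lspan R M (val ` smaller_words (h # xs @ ys))"
    "a \<odot>\<^bsub>M\<^esub> val (h # xs @ ys) \<oplus>\<^bsub>M\<^esub> l \<in> N" unfolding leading_coeffs_def by blast
  have v: "val (h # xs @ ys) \<in> grade M n" using val_grade[OF w] by (simp add: n_def)
  have l_gr: "l \<in> grade M n" using M.lspan_least[OF M.grade_submodule small_grade] l(1) by blast
  have "\<phi> (a \<odot>\<^bsub>M\<^esub> val (h # xs @ ys) \<oplus>\<^bsub>M\<^esub> l) \<in> N"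
    by (rule \<phi>_N[OF l(2) M.grade_add[OF M.grade_smult[OF a v] l_gr]])
  moreover have "\<phi> (a \<odot>\<^bsub>M\<^esub> val (h # xs @ ys) \<oplus>\<^bsub>M\<^esub> l) = a \<odot>\<^bsub>M\<^esub> val (h # xs @ c # ys) \<oplus>\<^bsub>M\<^esub> \<phi> l"
    using \<phi>_add[OF M.grade_smult[OF a v] l_gr] \<phi>_smult[OF a v] insert_letter_word(2)[OF w c]
    by (simp add: \<phi>_def n_def)
  ultimately show "a \<in> leading_coeffs N (h # xs @ c # ys)"
    unfolding leading_coeffs_def using a \<phi>_span[OF l(1)] by auto
qed

lemma leading_coeffs_subseq:
  assumes N: "tca_submodule R A M N" and "u \<in> words" "w \<in> words" "subseq u w"
  shows "leading_coeffs N u \<subseteq> leading_coeffs N w"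
proof -
  obtain h u' w' where u: "u = h # u'" and w: "w = h # w'"
    and ins: "(single_insert {..<d})\<^sup>*\<^sup>* u' w'" using words_subseq[OF assms(2-4)] .
  from ins have "h # w' \<in> words \<and> leading_coeffs N (h # u') \<subseteq> leading_coeffs N (h # w')"
  proof (induction rule: rtranclp_induct)
    case base
    then show ?case using assms(2) u by simp
  next
    case (step v v')
    from step.hyps(2) obtain c xs ys where "c < d" "v = xs @ ys" "v' = xs @ c # ys"
      by (auto elim: single_insert.cases)
    then show ?case
      using step.IH insert_letter_word(1)[of h xs ys c] leading_coeffs_insert[OF N, of h xs ys c] by auto
  qed
  then show ?thesis using u w by simp
qed

text \<open>Reduction by leading terms: an element of \<open>N\<close> shares its leading
  coefficient with some element of \<open>N'\<close>, and their difference lies in the span of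
  smaller words and, since \<open>N' \<subseteq> N\<close>, again in \<open>N\<close>.\<close>

lemma grade_subset_by_leading_coeffs:
  assumes N: "submodule N R M" and N': "submodule N' R M" "N' \<subseteq> N"
    and lead: "\<And>w. w \<in> words \<Longrightarrow> leading_coeffs N w \<subseteq> leading_coeffs N' w"
  shows "N \<inter> grade M n \<subseteq> N'"
proof -
  \<comment> \<open>Finite sets closed under smaller words are built up by adding their largest
    element. The closure condition makes the set below a new word \<open>b\<close> exactly
    \<open>smaller_words b\<close>, over which \<open>leading_coeffs\<close> is formed.\<close>
  have "N \<inter> lspan R M (val ` X) \<subseteq> N'"
    if "finite X" "X \<subseteq> words_of_degree n" "\<forall>w\<in>X. smaller_words w \<subseteq> X" for X
    using that
  proof (induction X rule: finite_linorder_max_induct)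
    case empty
    have "lspan R M {} \<subseteq> {\<zero>\<^bsub>M\<^esub>}" by (rule M.lspan_least[OF M.zero_submodule]) simp
    then show ?case using M.submodule_zero[OF N'(1)] by auto
  next
    case (insert b X)
    have b: "b \<in> words" and X: "X \<subseteq> words_of_degree n" using insert.prems by (auto simp: words_of_degree_def)
    have not_self: "b \<notin> smaller_words w" if "w \<in> X" for w
      using insert.hyps(2) that by (auto simp: smaller_words_def)
    have b_small: "smaller_words b = X"
    proof
      show "smaller_words b \<subseteq> X" using insert.prems(2) by (auto simp: smaller_words_def)
      show "X \<subseteq> smaller_words b"
        using insert.hyps(2) insert.prems(1) by (auto simp: smaller_words_def words_of_degree_def)
    qed
    have IH: "N \<inter> lspan R M (val ` X) \<subseteq> N'"
      using insert.IH X insert.prems(2) not_self by blast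
    note L = M.lspan_submodule[OF smaller_words_carrier[of b], unfolded b_small]
    show ?case
    proof
      fix y assume y: "y \<in> N \<inter> lspan R M (val ` insert b X)"
      then obtain a l where a: "a \<in> carrier R" and l: "l \<in> lspan R M (val ` X)"
        and y_eq: "y = a \<odot>\<^bsub>M\<^esub> val b \<oplus>\<^bsub>M\<^esub> l"
        using M.lspan_insertE[of y "val b" "val ` X"] val_carrier[OF b] smaller_words_carrier[of b] b_small
        by auto
      then have "a \<in> leading_coeffs N b"
        \<comment> \<open>The element \<open>y\<close> may have several expressions through words;
          the coefficient \<open>a\<close> of any one of them will do.\<close>
        using y unfolding leading_coeffs_def b_small by auto
      then obtain l' where l': "l' \<in> lspan R M (val ` X)" "a \<odot>\<^bsub>M\<^esub> val b \<oplus>\<^bsub>M\<^esub> l' \<in> N'"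
        using lead[OF b] unfolding leading_coeffs_def b_small by blast
      have car: "a \<odot>\<^bsub>M\<^esub> val b \<in> carrier M" "l \<in> carrier M" "l' \<in> carrier M"
        using a val_carrier[OF b] lspan_smaller_carrier[of _ b] l l'(1) b_small by simp_all
      define z where "z = a \<odot>\<^bsub>M\<^esub> val b \<oplus>\<^bsub>M\<^esub> l'"
      have diff: "y \<ominus>\<^bsub>M\<^esub> z = l \<ominus>\<^bsub>M\<^esub> l'"
        unfolding y_eq z_def a_minus_def using car
        by (simp add: M.M.minus_add M.M.add.m_ac M.M.r_neg1 M.M.r_neg)
      have "y \<ominus>\<^bsub>M\<^esub> z \<in> N"
        using M.submodule_minus[OF N, of y z] y l'(2) N'(2) z_def by blast
      moreover have "y \<ominus>\<^bsub>M\<^esub> z \<in> lspan R M (val ` X)"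
        unfolding diff by (rule M.submodule_minus[OF L l l'(1)])
      ultimately have "y \<ominus>\<^bsub>M\<^esub> z \<in> N'" using IH by blast
      then have "(y \<ominus>\<^bsub>M\<^esub> z) \<oplus>\<^bsub>M\<^esub> z \<in> N'"
        using M.submoduleE(5)[OF N'(1)] l'(2) z_def by blast
      moreover have "(y \<ominus>\<^bsub>M\<^esub> z) \<oplus>\<^bsub>M\<^esub> z = y"
        unfolding y_eq z_def a_minus_def using car by (simp add: M.M.add.m_assoc M.M.l_neg)
      ultimately show "y \<in> N'" by simp
    qed
  qed
  moreover have "finite (words_of_degree n)"
    unfolding words_of_degree_def by (rule finite_words_length)
  moreover have "\<forall>w\<in>words_of_degree n. smaller_words w \<subseteq> words_of_degree n"
    by (auto simp: smaller_words_def words_of_degree_def)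
  ultimately have "N \<inter> lspan R M (val ` words_of_degree n) \<subseteq> N'" by blast
  then show ?thesis using grade_lspan_words[of n] by blast
qed

lemma tca_submodule_subset_by_leading_coeffs:
  assumes N: "tca_submodule R A M N" and N': "tca_submodule R A M N'" "N' \<subseteq> N"
    and lead: "\<And>w. w \<in> words \<Longrightarrow> leading_coeffs N w \<subseteq> leading_coeffs N' w"
  shows "N \<subseteq> N'"
proof
  fix x assume x: "x \<in> N"
  have sub: "submodule N R M" "submodule N' R M" using N N'(1) by (simp_all add: tca_submodule_def)
  have "x \<in> carrier M" using M.submoduleE(1)[OF sub(1)] x by blast
  then obtain c where c: "homogeneous_components M x c" using M.direct_sum by blast
  have "c n \<in> N'" for n
  proof -
    have "c n \<in> N" using N x c unfolding tca_submodule_def graded_stable_def by blast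
    moreover have "c n \<in> grade M n" using c unfolding homogeneous_components_def by blast
    ultimately show ?thesis using grade_subset_by_leading_coeffs[OF sub N'(2) lead, of n] by blast
  qed
  then show "x \<in> N'"
    using c M.submodule_finsum[OF sub(2), of _ c] unfolding homogeneous_components_def by simp
qed

section \<open>Finite generation of submodules\<close>

lemma tca_submodule_inter:
  assumes "tca_submodule R A M N" "tca_submodule R A M N'"
  shows "tca_submodule R A M (N \<inter> N')"
proof -
  have sub: "submodule N R M" "submodule N' R M" using assms by (simp_all add: tca_submodule_def)
  have "submodule (N \<inter> N') R M"
    using M.submoduleE[OF sub(1)] M.submoduleE[OF sub(2)] M.submodule_zero[OF sub(1)]
      M.submodule_zero[OF sub(2)] by (intro M.submodule_by_smultI) auto
  then show ?thesis
    using assms unfolding tca_submodule_def graded_stable_def by blast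
qed

text \<open>Higman's lemma turns any sequence of words into an infinite chain of subsequences. The
  ideals ascend along it and become stationary, so two consecutive words of the chain have the same
  ideal.\<close>

lemma almost_full_on_leading_coeffs:
  assumes N: "tca_submodule R A M N"
  shows "almost_full_on (\<lambda>u w. subseq u w \<and> leading_coeffs N u = leading_coeffs N w) words"
  unfolding almost_full_on_def
proof (intro allI impI)
  fix f :: "nat \<Rightarrow> nat list" assume f: "range f \<subseteq> words"
  have sub: "submodule N R M" using N by (simp add: tca_submodule_def)
  have "almost_full_on subseq words"
    using almost_full_on_subseq words_finite_alphabet by (rule almost_full_on_subset) simp
  then obtain h :: "nat \<Rightarrow> nat" where h: "strict_mono h" "\<And>n. subseq (f (h n)) (f (h (Suc n)))"
    using almost_full_on_ascending[OF _ f] by metis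
  define I where "I n = leading_coeffs N (f (h n))" for n
  have I_Suc: "I n \<subseteq> I (Suc n)" for n
    unfolding I_def using f h(2) by (intro leading_coeffs_subseq[OF N]) auto
  then have I_mono: "I m \<subseteq> I n" if "m \<le> n" for m n using lift_Suc_mono_le[of I] that by blast
  have "ideal (I n) R" for n
    unfolding I_def using f by (intro leading_coeffs_ideal[OF sub]) auto
  then have "subset.chain {J. ideal J R} (range I)"
    using I_mono nat_le_linear unfolding subset_chain_def by blast
  \<comment> \<open>The ascending chain condition in its union form: the union of a nonempty chain
    of ideals belongs to the chain.\<close>
  then have "\<Union> (range I) \<in> range I"
    using noetherian_ring.ideal_chain_is_trivial[OF noetherian, of "range I"] by blast
  then obtain n where "\<Union> (range I) = I n" by blast
  then have "I (Suc n) = I n" using I_Suc by blast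
  moreover have "h n < h (Suc n)" using h(1) by (simp add: strict_mono_Suc_iff)
  ultimately show "\<exists>i j. i < j \<and> subseq (f i) (f j) \<and> leading_coeffs N (f i) = leading_coeffs N (f j)"
    using h(2) unfolding I_def by metis
qed

text \<open>The generating set \<open>G\<close> has one element of \<open>N\<close> for each basis
  word \<open>u\<close> and each member of a finite generating set of the ideal at
  \<open>u\<close>.\<close>

lemma tca_submodule_finitely_generated:
  assumes N: "tca_submodule R A M N"
  shows "finitely_generated_submodule R A M N"
proof -
  have sub: "submodule N R M" using N by (simp add: tca_submodule_def)
  obtain F where F: "finite F" "F \<subseteq> words"
    and F_basis: "\<And>w. w \<in> words \<Longrightarrow> \<exists>u\<in>F. subseq u w \<and> leading_coeffs N u = leading_coeffs N w"
    using almost_full_on_finite_basis[OF almost_full_on_leading_coeffs[OF N]] by metis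
  have "\<forall>u\<in>F. \<exists>B. finite B \<and> B \<subseteq> carrier R \<and> leading_coeffs N u = Idl\<^bsub>R\<^esub> B"
    using noetherian_ring.finetely_gen[OF noetherian] leading_coeffs_ideal[OF sub] F(2) by (metis subsetD)
  then obtain B where B: "\<And>u. u \<in> F \<Longrightarrow> finite (B u) \<and> B u \<subseteq> carrier R \<and> leading_coeffs N u = Idl\<^bsub>R\<^esub> (B u)"
    by metis
  have B_lead: "B u \<subseteq> leading_coeffs N u" if "u \<in> F" for u
    using B[OF that] ring.genideal_self[OF ring_R] by metis
  define lift where "lift u b = (SOME l. l \<in> lspan R M (val ` smaller_words u)
      \<and> b \<odot>\<^bsub>M\<^esub> val u \<oplus>\<^bsub>M\<^esub> l \<in> N)" for u b
  have lift: "lift u b \<in> lspan R M (val ` smaller_words u)" "b \<odot>\<^bsub>M\<^esub> val u \<oplus>\<^bsub>M\<^esub> lift u b \<in> N"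
    if "u \<in> F" "b \<in> B u" for u b
  proof -
    have "\<exists>l. l \<in> lspan R M (val ` smaller_words u) \<and> b \<odot>\<^bsub>M\<^esub> val u \<oplus>\<^bsub>M\<^esub> l \<in> N"
      using B_lead[OF that(1)] that(2) unfolding leading_coeffs_def by blast
    from someI_ex[OF this] show "lift u b \<in> lspan R M (val ` smaller_words u)"
      "b \<odot>\<^bsub>M\<^esub> val u \<oplus>\<^bsub>M\<^esub> lift u b \<in> N" unfolding lift_def by blast+
  qed
  define G where "G = (\<Union>u\<in>F. (\<lambda>b. b \<odot>\<^bsub>M\<^esub> val u \<oplus>\<^bsub>M\<^esub> lift u b) ` B u)"
  have "finite G" unfolding G_def using F(1) B by blast
  moreover have "G \<subseteq> (\<Union>n. grade M n)"
  proof
    fix x assume "x \<in> G"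
    then obtain u b where ub: "u \<in> F" "b \<in> B u" "x = b \<odot>\<^bsub>M\<^esub> val u \<oplus>\<^bsub>M\<^esub> lift u b"
      unfolding G_def by blast
    define n where "n = length u - 1"
    have "val ` smaller_words u \<subseteq> grade M n"
      using val_grade by (fastforce simp: smaller_words_def n_def)
    then have "lift u b \<in> grade M n"
      using lift(1)[OF ub(1,2)] M.lspan_least[OF M.grade_submodule] by blast
    moreover have "b \<in> carrier R" using B[OF ub(1)] ub(2) by blast
    moreover have "val u \<in> grade M n" unfolding n_def by (rule val_grade) (use F(2) ub(1) in blast)
    ultimately have "x \<in> grade M n" unfolding ub(3) by (intro M.grade_add M.grade_smult)
    then show "x \<in> (\<Union>n. grade M n)" by blast
  qed
  moreover have "submodule_generated R A M G = N"
  proof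
    have G_N: "G \<subseteq> N" unfolding G_def using lift(2) by blast
    then show "submodule_generated R A M G \<subseteq> N"
      unfolding submodule_generated_def using N by blast
    have "N \<subseteq> N'" if N': "tca_submodule R A M N'" "G \<subseteq> N'" for N'
    proof -
      \<comment> \<open>The comparison of leading coefficients requires a submodule of \<open>N\<close>.\<close>
      define K where "K = N \<inter> N'"
      have K: "tca_submodule R A M K" "K \<subseteq> N" "G \<subseteq> K"
        using tca_submodule_inter[OF N N'(1)] N'(2) G_N by (auto simp: K_def)
      have subK: "submodule K R M" using K(1) by (simp add: tca_submodule_def)
      have "leading_coeffs N w \<subseteq> leading_coeffs K w" if w: "w \<in> words" for w
      proof -
        obtain u where u: "u \<in> F" "subseq u w" "leading_coeffs N u = leading_coeffs N w"
          using F_basis[OF w] by blast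
        have uw: "u \<in> words" using u(1) F(2) by blast
        \<comment> \<open>Each chosen lift lies in \<open>G\<close>, hence in \<open>K\<close>, and
          exhibits its generator as a leading coefficient. The whole ideal at \<open>u\<close>
          follows, and the basis word passes it on to \<open>w\<close>.\<close>
        have "B u \<subseteq> leading_coeffs K u"
          using lift(1)[OF u(1)] B[OF u(1)] K(3) u(1) unfolding leading_coeffs_def G_def by blast
        then have "leading_coeffs N u \<subseteq> leading_coeffs K u"
          using B[OF u(1)] ring.genideal_minimal[OF ring_R leading_coeffs_ideal[OF subK uw]]
          by metis
        then show ?thesis using u(3) leading_coeffs_subseq[OF K(1) uw w u(2)] by blast
      qed
      then have "N \<subseteq> K" by (rule tca_submodule_subset_by_leading_coeffs[OF N K(1,2)])
      then show ?thesis by (simp add: K_def)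
    qed
    then show "N \<subseteq> submodule_generated R A M G"
      unfolding submodule_generated_def by blast
  qed
  ultimately show ?thesis unfolding finitely_generated_submodule_def by blast
qed

end

theorem corollary7p2p7:
  fixes R :: "('k, 'r) ring_scheme"
    and A :: "('k, 'a) sym_module"
  assumes "cring R" and "noetherian_ring R"
    and "twisted_comm_algebra R A"
    and "finitely_generated_degree_one R A"
  shows "noetherian_tca TYPE('m) R A"
  unfolding noetherian_tca_def
proof (intro allI impI)
  fix M :: "('k, 'a, 'm) act_module" and N
  assume M: "tca_module R A M \<and> finitely_generated_submodule R A M (carrier M)"
    and N: "tca_submodule R A M N"
  obtain S where S: "finite S" "S \<subseteq> grade A 1" "tca_generated R A S = carrier A"
    using assms(4) unfolding finitely_generated_degree_one_def by blast
  obtain d and s :: "nat \<Rightarrow> 'a" where s: "S = s ` {i. i < d}"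
    using finite_imp_nat_seg_image_inj_on[OF S(1)] by blast
  obtain T where T: "finite T" "T \<subseteq> (\<Union>n. grade M n)" "submodule_generated R A M T = carrier M"
    using M unfolding finitely_generated_submodule_def by blast
  obtain r and t :: "nat \<Rightarrow> 'm" where t: "T = t ` {i. i < r}"
    using finite_imp_nat_seg_image_inj_on[OF T(1)] by blast
  have "\<forall>j. \<exists>n. j < r \<longrightarrow> t j \<in> grade M n" using T(2) t by blast
  then obtain e where e: "\<And>j. j < r \<Longrightarrow> t j \<in> grade M (e j)" by metis
  have "tca_module R A M" using M by blast
  then have "generated_tca_module R A M s d t e r"
    unfolding generated_tca_module_def degree_one_tca_def degree_one_tca_axioms_def
      generated_tca_module_axioms_def
    using S T s t e assms(2,3) by (auto simp: lessThan_def)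
  then show "finitely_generated_submodule R A M N"
    using N by (rule generated_tca_module.tca_submodule_finitely_generated)
qed

end
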